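(* Let $f:\mathbb{Z}_{\geq 1}\to\mathbb{C}$ be an arithmetic function such that $f(n)\ll n^{\alpha}$ for all $n\geq 1$, for some fixed $\alpha\in[0,1)$. For $x\geq 2$ define \[ T_f(x)=\sum_{n_1n_2\leq x} f\left(\left\lfloor \frac{x}{n_1n_2}\right\rfloor\right)=\sum_{n\leq x} f\left(\left\lfloor \frac{x}{n}\right\rfloor\right)\tau(n), \] where the first sum is over pairs of positive integers $(n_1,n_2)$ and $\tau(n)$ is the number of positive divisors of $n$. Put \[ C_1(f)=\sum_{d\geq 1}\frac{f(d)}{d(d+1)},\qquad C_3(f)=\sum_{d\geq 1} f(d)\left(\frac{\log d}{d}-\frac{\log(d+1)}{d+1}\right),\qquad C_2(f)=(2\gamma-1)C_1(f)-C_3(f), \] where $\gamma$ is Euler's constant (both series converge since $\alpha<1$). Then for every $\varepsilon>0$ and all $x\geq 2$, \[ T_f(x)=C_1(f)\,x\log x+C_2(f)\,x+O\left(x^{\frac{4+3\alpha}{7}+\varepsilon}\right), \] where the implied constant depends on $f$, $\alpha$ and $\varepsilon$.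
   Context: $\lfloor t\rfloor$ denotes the largest integer not exceeding $t$. *)

theory Defs
  imports "HOL-Analysis.Analysis"
begin

definition tau :: "nat \<Rightarrow> nat" where
  "tau n = card {d. d dvd n \<and> d \<ge> 1}"

definition T_f :: "(nat \<Rightarrow> complex) \<Rightarrow> real \<Rightarrow> complex" where
  "T_f f x = (\<Sum>p\<in>{(n1, n2). n1 \<ge> 1 \<and> n2 \<ge> 1 \<and> real (n1 * n2) \<le> x}.
                 f (nat \<lfloor>x / real (fst p * snd p)\<rfloor>))"

definition C1 :: "(nat \<Rightarrow> complex) \<Rightarrow> complex" where
  "C1 f = (\<Sum>n. f (n + 1) / of_nat ((n + 1) * (n + 2)))"

definition C3 :: "(nat \<Rightarrow> complex) \<Rightarrow> complex" where
  "C3 f = (\<Sum>n. f (n + 1) * of_real (ln (real (n + 1)) / real (n + 1)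
                                      - ln (real (n + 2)) / real (n + 2)))"

definition C2 :: "(nat \<Rightarrow> complex) \<Rightarrow> complex" where
  "C2 f = of_real (2 * euler_mascheroni - 1) * C1 f - C3 f"

end

theory Submission
  imports Defs
begin

text \<open>
  Let \<open>\<Delta>(y)\<close> be the error term in Dirichlet's divisor problem. Grouping the pairs by
  \<open>d = \<lfloor>x / (n\<^sub>1 n\<^sub>2)\<rfloor>\<close>, the values \<open>d > x powr (3/7)\<close> are estimated trivially, and for
  \<open>d \<le> x powr (3/7)\<close> everything reduces to \<open>\<Sum> \<bar>\<Delta>(x / d)\<bar> \<lless> x powr (4/7 + \<epsilon>)\<close>. Pointwise bounds
  for \<open>\<Delta>\<close> do not suffice, but a mean square bound does. By the hyperbola method
  \<open>\<Delta>(y) = -2 \<Sum> saw (y / n) + O(1)\<close> with \<open>n \<le> sqrt y\<close>, and truncating the Fourier series of the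
  sawtooth function gives \<open>\<integral> \<Delta>\<^sup>2 \<lless> W powr (3/2 + \<epsilon>)\<close> on \<open>[0, W]\<close>. The counting function is
  monotone, so a large value \<open>V\<close> of \<open>\<bar>\<Delta>(x / d)\<bar>\<close> persists, up to a factor 2, on an interval of length about
  \<open>V / ln x\<close> on one side of \<open>x / d\<close>. The points \<open>x / d\<close> with \<open>d \<le> 2 x powr (3/7)\<close> are so well spaced
  that these intervals are disjoint, which bounds the number of large values by the integral.
\<close>

subsection \<open>The hyperbola method\<close>

definition hyp_pairs :: "real \<Rightarrow> (nat \<times> nat) set" where
  "hyp_pairs y = {(a, b). a \<ge> 1 \<and> b \<ge> 1 \<and> real (a * b) \<le> y}"

definition divisor_sum :: "real \<Rightarrow> nat" where
  "divisor_sum y = card (hyp_pairs y)"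

definition divisor_main :: "real \<Rightarrow> real" where
  "divisor_main y = y * ln y + (2 * euler_mascheroni - 1) * y"

definition divisor_error :: "real \<Rightarrow> real" where
  "divisor_error y = real (divisor_sum y) - divisor_main y"

definition saw :: "real \<Rightarrow> real" where
  "saw t = frac t - 1/2"

definition saw_sum :: "real \<Rightarrow> real" where
  "saw_sum y = (\<Sum>n=1..nat \<lfloor>sqrt y\<rfloor>. saw (y / real n))"

lemma abs_saw_le: "\<bar>saw t\<bar> \<le> 1/2"
  using frac_lt_1[of t] frac_ge_0[of t] unfolding saw_def by linarith

lemma hyp_pairs_subset: "hyp_pairs y \<subseteq> {1..nat \<lfloor>y\<rfloor>} \<times> {1..nat \<lfloor>y\<rfloor>}"
proof
  fix p assume "p \<in> hyp_pairs y"
  then obtain a b where p: "p = (a, b)" "a \<ge> 1" "b \<ge> 1" "real (a * b) \<le> y"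
    by (auto simp: hyp_pairs_def)
  have "a \<le> a * b" "b \<le> a * b" using p by auto
  moreover have "a * b \<le> nat \<lfloor>y\<rfloor>" using p(4) by (simp add: le_nat_floor)
  ultimately have "a \<le> nat \<lfloor>y\<rfloor>" "b \<le> nat \<lfloor>y\<rfloor>" by linarith+
  thus "p \<in> {1..nat \<lfloor>y\<rfloor>} \<times> {1..nat \<lfloor>y\<rfloor>}" using p by simp
qed

lemma finite_hyp_pairs [simp]: "finite (hyp_pairs y)"
  by (rule finite_subset[OF hyp_pairs_subset]) auto

lemma hyp_pairs_mono: "y \<le> z \<Longrightarrow> hyp_pairs y \<subseteq> hyp_pairs z"
  by (auto simp: hyp_pairs_def)

lemma divisor_sum_mono: "y \<le> z \<Longrightarrow> divisor_sum y \<le> divisor_sum z"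
  unfolding divisor_sum_def by (intro card_mono hyp_pairs_mono finite_hyp_pairs)

lemma hyp_pairs_empty: "y < 1 \<Longrightarrow> hyp_pairs y = {}"
  using hyp_pairs_subset[of y] by (auto simp: nat_eq_iff)

text \<open>First-order Euler-Maclaurin summation at a real argument: Euler's constant exceeds
  \<open>harm r - ln (r + 1)\<close> by an amount between \<open>1 / (2 * (r + 1))\<close> and
  \<open>1 / (2 * r)\<close>, and \<open>ln (r + 1) = ln u + ln (1 + z)\<close>. The first-order
  terms \<open>1 / (2 * u)\<close> and \<open>z\<close> combine to \<open>saw u / u\<close>. An
  error of order 1/u^2 is required because it is later multiplied by \<open>y\<close>, where
  \<open>u = sqrt y\<close>.\<close>

lemma harm_floor_bound:
  assumes "u \<ge> 1"
  shows "\<bar>harm (nat \<lfloor>u\<rfloor>) - ln u - euler_mascheroni + saw u / u\<bar> \<le> 2 / u\<^sup>2"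
proof -
  define r where "r = nat \<lfloor>u\<rfloor>"
  have r1: "r \<ge> 1" using assms by (simp add: r_def le_nat_floor)
  have fl: "real r = of_int \<lfloor>u\<rfloor>" using assms by (simp add: r_def)
  have ru: "real r \<le> u" "u < real r + 1" using fl by linarith+
  have su: "saw u = u - real r - 1/2" by (simp add: saw_def frac_def fl)
  have lo: "euler_mascheroni \<ge> harm r - ln (real r + 1) + 1 / (2 * (real r + 1))"
    and up: "euler_mascheroni \<le> harm r - ln (real r + 1) + 1 / (2 * real r)"
    using euler_mascheroni_lower[of "r - 1"] euler_mascheroni_upper[of "r - 1"] r1
    by (simp_all add: of_nat_diff algebra_simps)
  define z where "z = (real r + 1 - u) / u"
  have z: "0 \<le> z" "z \<le> 1" using ru r1 assms by (auto simp: z_def divide_simps)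
  have z2: "z\<^sup>2 \<le> 1 / u\<^sup>2"
  proof -
    have "z \<le> 1 / u" unfolding z_def using ru assms by (intro divide_right_mono) auto
    hence "z\<^sup>2 \<le> (1/u)\<^sup>2" using z by (intro power_mono) auto
    thus ?thesis by (simp add: power_divide)
  qed
  have "u * (1 + z) = real r + 1" using assms by (simp add: z_def field_simps)
  hence "ln (real r + 1) = ln (u * (1 + z))" by simp
  also have "\<dots> = ln u + ln (1 + z)" using assms z by (intro ln_mult_pos) auto
  finally have lnr: "ln (real r + 1) = ln u + ln (1 + z)" .
  have l1: "ln (1 + z) \<le> z" using z by (intro ln_add_one_self_le_self) auto
  have l2: "ln (1 + z) \<ge> z - z\<^sup>2" using z by (intro ln_one_plus_pos_lower_bound) auto
  have e1: "1 / (2 * u) - 1 / (2 * (real r + 1)) \<le> 1 / u\<^sup>2"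
  proof -
    have "1 / (2 * u) - 1 / (2 * (real r + 1)) = (real r + 1 - u) / (2 * u * (real r + 1))"
      using assms by (simp add: divide_simps) (simp add: algebra_simps)
    also have "\<dots> \<le> 1 / (2 * u * u)"
      using ru assms by (intro frac_le) (auto intro!: mult_mono)
    also have "\<dots> \<le> 1 / u\<^sup>2" using assms by (simp add: power2_eq_square field_simps)
    finally show ?thesis .
  qed
  have e2: "1 / (2 * real r) - 1 / (2 * u) \<le> 1 / u\<^sup>2"
  proof -
    have "1 / (2 * real r) - 1 / (2 * u) = (u - real r) / (2 * real r * u)"
      using assms r1 by (simp add: divide_simps)
    also have "\<dots> \<le> 1 / (u * u)"
      using ru assms r1 by (intro frac_le mult_right_mono) auto
    finally show ?thesis by (simp add: power2_eq_square)
  qed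
  have s: "saw u / u = 1 / (2 * u) - z"
    using assms by (simp add: su z_def field_simps)
  have "\<bar>harm r - ln u - euler_mascheroni + saw u / u\<bar> \<le> 2 * (1 / u\<^sup>2)"
    unfolding s abs_le_iff using lo up lnr l1 l2 e1 e2 z2 by linarith
  thus ?thesis by (simp add: r_def)
qed

lemma le_nat_floor_sqrt_iff:
  assumes "y \<ge> 0"
  shows "n \<le> nat \<lfloor>sqrt y\<rfloor> \<longleftrightarrow> (real n)\<^sup>2 \<le> y"
proof -
  have "n \<le> nat \<lfloor>sqrt y\<rfloor> \<longleftrightarrow> real n \<le> sqrt y"
    using assms by (subst le_nat_iff) (auto simp: le_floor_iff)
  also have "\<dots> \<longleftrightarrow> (real n)\<^sup>2 \<le> y"
    using assms real_le_rsqrt[of "real n" y] real_sqrt_le_iff[of "(real n)\<^sup>2" y] by auto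
  finally show ?thesis .
qed

text \<open>One component of every pair is at most \<open>sqrt y\<close>, so the set
  \<open>A\<close> with small first component and its mirror image \<open>B\<close> cover
  \<open>hyp_pairs y\<close>. They meet exactly in the square of side \<open>r\<close>, and
  inclusion-exclusion gives the subtracted term.\<close>

lemma divisor_sum_hyperbola:
  assumes "y \<ge> 1"
  shows "real (divisor_sum y) = 2 * (\<Sum>n=1..nat \<lfloor>sqrt y\<rfloor>. real (nat \<lfloor>y / real n\<rfloor>)) - (real (nat \<lfloor>sqrt y\<rfloor>))\<^sup>2"
proof -
  define r where "r = nat \<lfloor>sqrt y\<rfloor>"
  define A where "A = Sigma {1..r} (\<lambda>a. {1..nat \<lfloor>y / real a\<rfloor>})"
  define B where "B = prod.swap ` A"
  have memA: "(a, b) \<in> A \<longleftrightarrow> a \<ge> 1 \<and> a \<le> r \<and> b \<ge> 1 \<and> real (a * b) \<le> y" for a b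
  proof (cases "a \<ge> 1")
    case True
    have "b \<le> nat \<lfloor>y / real a\<rfloor> \<longleftrightarrow> real b \<le> y / real a"
      using assms by (subst le_nat_iff) (auto simp: le_floor_iff)
    also have "\<dots> \<longleftrightarrow> real (a * b) \<le> y" using True by (simp add: field_simps)
    finally show ?thesis by (auto simp: A_def)
  qed (auto simp: A_def)
  have memB: "(a, b) \<in> B \<longleftrightarrow> (b, a) \<in> A" for a b
    by (auto simp: B_def image_iff intro!: bexI[of _ "(b, a)"])
  have le_r: "n \<le> r \<longleftrightarrow> real n * real n \<le> y" for n
    using le_nat_floor_sqrt_iff[of y n] assms by (simp add: r_def power2_eq_square)
  have un: "hyp_pairs y = A \<union> B"
  proof (rule set_eqI, clarify)
    fix a b
    have "a \<le> r \<or> b \<le> r" if "real (a * b) \<le> y"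
    proof (rule ccontr)
      assume "\<not> ?thesis"
      hence *: "real a * real a > y" "real b * real b > y" using le_r by auto
      have "min a b * min a b \<le> a * b" by (intro mult_mono) auto
      hence "real (min a b) * real (min a b) \<le> real (a * b)"
        by (metis of_nat_mult of_nat_le_iff)
      thus False using * that by (auto simp: min_def split: if_splits)
    qed
    thus "(a, b) \<in> hyp_pairs y \<longleftrightarrow> (a, b) \<in> A \<union> B"
      by (auto simp: memA memB hyp_pairs_def mult.commute)
  qed
  have int: "A \<inter> B = {1..r} \<times> {1..r}"
  proof (rule set_eqI, clarify)
    fix a b
    have "real (a * b) \<le> y" if "a \<le> r" "b \<le> r"
    proof -
      have "a * b \<le> max a b * max a b" by (intro mult_mono) auto
      hence "real (a * b) \<le> real (max a b) * real (max a b)"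
        by (metis of_nat_mult of_nat_le_iff)
      also have "\<dots> \<le> y" using that le_r[of "max a b"] by auto
      finally show ?thesis .
    qed
    thus "(a, b) \<in> A \<inter> B \<longleftrightarrow> (a, b) \<in> {1..r} \<times> {1..r}"
      by (auto simp: memA memB mult.commute)
  qed
  have fin: "finite A" "finite B" by (auto simp: A_def B_def)
  have "card B = card A" unfolding B_def by (rule card_image) (auto simp: inj_on_def)
  hence "divisor_sum y + r * r = 2 * card A"
    using card_Un_Int[OF fin] by (simp add: divisor_sum_def un int)
  also have "card A = (\<Sum>n=1..r. nat \<lfloor>y / real n\<rfloor>)" by (simp add: A_def)
  finally have "real (divisor_sum y) + real r * real r = 2 * (\<Sum>n=1..r. real (nat \<lfloor>y / real n\<rfloor>))"
    by (metis (mono_tags, lifting) of_nat_add of_nat_mult of_nat_numeral of_nat_sum sum.cong)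
  thus ?thesis by (simp add: r_def power2_eq_square)
qed

text \<open>Once each floor in the hyperbola formula is written through \<open>saw\<close>, the
  terms \<open>2 * u * saw u\<close> coming from \<open>y * harm r\<close> and from the square of
  \<open>r\<close> cancel. Everything left beside \<open>saw_sum\<close> is bounded. Small
  \<open>y\<close> is included because the mean squares below are taken over intervals that start at
  0.\<close>

lemma divisor_error_saw_sum:
  assumes "y > 0"
  shows "\<bar>divisor_error y + 2 * saw_sum y\<bar> \<le> 5"
proof (cases "y < 1")
  case True
  have "ln (1 / y) \<le> 1 / y - 1" using assms by (intro ln_le_minus_one) auto
  hence "- ln y * y \<le> (1 / y - 1) * y"
    using assms by (intro mult_right_mono) (auto simp: ln_div)
  also have "(1 / y - 1) * y \<le> 1" using assms by (simp add: left_diff_distrib)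
  finally have "- (y * ln y) \<le> 1" by (simp add: mult.commute)
  moreover have "y * ln y \<le> 0" using assms True by (simp add: mult_nonneg_nonpos)
  moreover have "\<bar>(2 * euler_mascheroni - 1) * y\<bar> \<le> 1 * 1" unfolding abs_mult
    using assms True euler_mascheroni_gt_19_over_33 euler_mascheroni_less_13_over_22
    by (intro mult_mono) auto
  moreover have "nat \<lfloor>sqrt y\<rfloor> = 0" using True assms by (simp add: nat_eq_iff floor_le_zero)
  ultimately show ?thesis using True
    by (simp add: divisor_error_def divisor_main_def divisor_sum_def saw_sum_def hyp_pairs_empty)
next
  case False
  hence y: "y \<ge> 1" by simp
  define u where "u = sqrt y"
  have u: "u \<ge> 1" "u * u = y" using y by (auto simp: u_def)
  define r where "r = nat \<lfloor>u\<rfloor>"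
  define e where "e = harm r - ln u - euler_mascheroni + saw u / u"
  have r: "real r = u - saw u - 1/2" using u by (simp add: r_def saw_def frac_def)
  have fl: "real (nat \<lfloor>y / real n\<rfloor>) = y / real n - saw (y / real n) - 1/2" for n
    using y by (simp add: saw_def frac_def)
  have "real (divisor_sum y) = 2 * (\<Sum>n=1..r. y / real n - saw (y / real n) - 1/2) - (real r)\<^sup>2"
    using divisor_sum_hyperbola[OF y] by (simp add: fl r_def u_def)
  also have "(\<Sum>n=1..r. y / real n - saw (y / real n) - 1/2) = y * harm r - saw_sum y - real r / 2"
  proof -
    have "(\<Sum>n=1..r. y / real n) = y * harm r"
      by (simp add: harm_def sum_distrib_left divide_inverse)
    thus ?thesis by (simp add: sum_subtractf saw_sum_def r_def u_def)
  qed
  finally have "real (divisor_sum y) = 2 * y * harm r - 2 * saw_sum y - (real r + (real r)\<^sup>2)"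
    by (simp add: algebra_simps)
  moreover have "real r + (real r)\<^sup>2 = y - 2 * u * saw u + (saw u)\<^sup>2 - 1/4"
    unfolding r using u by (simp add: power2_eq_square algebra_simps)
  moreover have "2 * y * harm r = y * ln y + 2 * euler_mascheroni * y - 2 * u * saw u + 2 * y * e"
  proof -
    have "harm r = e + ln u + euler_mascheroni - saw u / u" by (simp add: e_def)
    hence "2 * y * harm r = 2 * y * (e + ln u + euler_mascheroni - saw u / u)" by simp
    hence "2 * y * harm r = 2 * y * e + 2 * y * ln u + 2 * y * euler_mascheroni - 2 * (y * (saw u / u))"
      by (simp only: ring_distribs mult.assoc)
    moreover have "2 * y * ln u = y * ln y" using y by (simp add: u_def ln_sqrt)
    moreover have "y * (saw u / u) = u * saw u" using u by (simp add: field_simps flip: u(2))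
    ultimately show ?thesis by simp
  qed
  ultimately have eq: "divisor_error y + 2 * saw_sum y = 1/4 - (saw u)\<^sup>2 + 2 * (y * e)"
    by (simp add: divisor_error_def divisor_main_def algebra_simps)
  have "\<bar>y * e\<bar> \<le> y * (2 / u\<^sup>2)"
    unfolding abs_mult using harm_floor_bound[OF u(1)] y
    by (intro mult_mono) (simp_all add: e_def r_def)
  also have "\<dots> = 2" using u y by (simp add: power2_eq_square)
  finally have "\<bar>y * e\<bar> \<le> 2" .
  moreover have "(saw u)\<^sup>2 \<le> (1/2)\<^sup>2" using abs_saw_le[of u] abs_le_square_iff[of "saw u" "1/2"] by simp
  moreover have "0 \<le> (saw u)\<^sup>2" by simp
  ultimately show ?thesis unfolding eq power2_eq_square by linarith
qed

subsection \<open>Mean square of the sawtooth sum\<close>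

lemma has_integral_sin_mult_sin:
  fixes a b p q :: real
  assumes "p \<le> q" "a \<noteq> b" "a \<noteq> -b"
  defines "F \<equiv> \<lambda>s. sin ((a - b) * s) / (2 * (a - b)) - sin ((a + b) * s) / (2 * (a + b))"
  shows "((\<lambda>s. sin (a * s) * sin (b * s)) has_integral F q - F p) {p..q}"
proof (rule fundamental_theorem_of_calculus[OF assms(1)])
  fix s assume "s \<in> {p..q}"
  have nz: "a - b \<noteq> 0" "a + b \<noteq> 0" using assms by auto
  have cancel: "c * d / (2 * d) = c / 2" if "d \<noteq> 0" for c d :: real using that by simp
  have "(F has_real_derivative cos ((a - b) * s) * (a - b) / (2 * (a - b))
          - cos ((a + b) * s) * (a + b) / (2 * (a + b))) (at s within {p..q})"
    unfolding F_def using nz by (auto intro!: derivative_eq_intros)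
  also have "cos ((a - b) * s) * (a - b) / (2 * (a - b)) - cos ((a + b) * s) * (a + b) / (2 * (a + b))
      = (cos (a * s - b * s) - cos (a * s + b * s)) / 2"
    unfolding cancel[OF nz(1)] cancel[OF nz(2)] by (simp add: left_diff_distrib distrib_right diff_divide_distrib)
  also have "\<dots> = sin (a * s) * sin (b * s)" by (simp add: cos_diff cos_add)
  finally show "(F has_vector_derivative sin (a * s) * sin (b * s)) (at s within {p..q})"
    by (simp add: has_real_derivative_iff_has_vector_derivative)
qed

lemma has_integral_sin_squared:
  fixes a p q :: real
  assumes "p \<le> q" "a \<noteq> 0"
  defines "F \<equiv> \<lambda>s. s / 2 - sin (2 * a * s) / (4 * a)"
  shows "((\<lambda>s. (sin (a * s))\<^sup>2) has_integral F q - F p) {p..q}"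
proof (rule fundamental_theorem_of_calculus[OF assms(1)])
  fix s assume "s \<in> {p..q}"
  have "(F has_real_derivative 1 / 2 - cos (2 * a * s) * (2 * a) / (4 * a)) (at s within {p..q})"
    unfolding F_def using assms(2) by (auto intro!: derivative_eq_intros)
  also have "1 / 2 - cos (2 * a * s) * (2 * a) / (4 * a) = (1 - cos (2 * (a * s))) / 2"
    using assms(2) by (simp add: field_simps)
  also have "\<dots> = (sin (a * s))\<^sup>2" by (simp add: cos_double_sin)
  finally show "(F has_vector_derivative (sin (a * s))\<^sup>2) (at s within {p..q})"
    by (simp add: has_real_derivative_iff_has_vector_derivative)
qed

lemma has_integral_linear_mult_sin:
  fixes a p q :: real
  assumes "p \<le> q" "a \<noteq> 0"
  defines "F \<equiv> \<lambda>s. 1 / a\<^sup>2 * sin (a * s) - 1 / a * ((s - 1/2) * cos (a * s))"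
  shows "((\<lambda>s. (s - 1/2) * sin (a * s)) has_integral F q - F p) {p..q}"
proof (rule fundamental_theorem_of_calculus[OF assms(1)])
  fix s assume "s \<in> {p..q}"
  define u v where "u = 1 / a\<^sup>2" and "v = 1 / a"
  have "(F has_real_derivative u * (cos (a * s) * a) - v * (cos (a * s) - (s - 1/2) * (sin (a * s) * a)))
          (at s within {p..q})"
    unfolding F_def u_def[symmetric] v_def[symmetric]
    by (auto intro!: derivative_eq_intros simp: algebra_simps)
  also have "u * (cos (a * s) * a) - v * (cos (a * s) - (s - 1/2) * (sin (a * s) * a)) = (s - 1/2) * sin (a * s)"
    using assms(2) by (simp add: u_def v_def power2_eq_square right_diff_distrib)
  finally show "(F has_vector_derivative (s - 1/2) * sin (a * s)) (at s within {p..q})"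
    by (simp only: has_real_derivative_iff_has_vector_derivative)
qed

section \<open>The truncated Fourier series of the sawtooth function\<close>

definition fourier_poly :: "nat \<Rightarrow> real \<Rightarrow> real" where
  "fourier_poly N t = (\<Sum>h=1..N. sin (2 * real h * pi * t) / (pi * real h))"

lemma sin_2n_pi_diff:
  "sin (2 * real n * pi * (t - real k)) = sin (2 * real n * pi * t)"
proof -
  have "2 * real n * pi * (t - real k) = 2 * real n * pi * t - 2 * real (n * k) * pi"
    by (simp add: algebra_simps)
  thus ?thesis by (simp only: sin_diff sin_2npi cos_2npi)
qed

lemma fourier_poly_periodic: "fourier_poly N (t - real k) = fourier_poly N t"
  unfolding fourier_poly_def by (simp only: sin_2n_pi_diff)

text \<open>All frequencies of \<open>fourier_poly N\<close> lie below \<open>n\<close>, so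
  orthogonality removes the polynomial and only the sine integral of \<open>s - 1/2\<close>
  survives. This is the cross term in the induction of the next lemma.\<close>

lemma has_integral_linear_fourier_mult_sin:
  assumes "n > N"
  shows "((\<lambda>s. (s - 1/2 + fourier_poly N s) * sin (2 * real n * pi * s)) has_integral
            (- 1 / (2 * real n * pi))) {0..1}"
proof -
  have 1: "((\<lambda>s. (s - 1/2) * sin (2 * real n * pi * s)) has_integral (- 1 / (2 * real n * pi))) {0..1}"
  proof -
    define a where "a = 2 * real n * pi"
    have "sin a = 0" "cos a = 1" "a \<noteq> 0" using assms by (simp_all add: a_def)
    thus ?thesis using has_integral_linear_mult_sin[of 0 1 a] by (simp flip: a_def)
  qed
  have 2: "((\<lambda>s. sin (2 * real h * pi * s) * sin (2 * real n * pi * s)) has_integral 0) {0..1}"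
    if h: "h \<in> {1..N}" for h
  proof -
    have ne: "2 * real h * pi \<noteq> 2 * real n * pi" using h assms by simp
    have pos: "2 * real h * pi > 0" "2 * real n * pi > 0" using h assms by simp_all
    have "2 * real h * pi - 2 * real n * pi = - (2 * real (n - h) * pi)"
      "2 * real h * pi + 2 * real n * pi = 2 * real (n + h) * pi"
      using h assms by (simp_all add: of_nat_diff algebra_simps)
    hence "sin (2 * real h * pi - 2 * real n * pi) = 0" "sin (2 * real h * pi + 2 * real n * pi) = 0"
      by (simp_all only: sin_minus sin_2npi)
    thus ?thesis
      using has_integral_sin_mult_sin[of 0 1 "2 * real h * pi" "2 * real n * pi"] ne pos by simp
  qed
  have "((\<lambda>s. \<Sum>h=1..N. 1 / (pi * real h) * (sin (2 * real h * pi * s) * sin (2 * real n * pi * s)))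
          has_integral (\<Sum>h=1..N. 1 / (pi * real h) * 0)) {0..1}"
    by (intro has_integral_sum has_integral_mult_right 2) auto
  from has_integral_add[OF 1 this] show ?thesis
    by (simp add: fourier_poly_def sum_distrib_right sum_distrib_left algebra_simps)
qed

text \<open>Bessel's identity by induction. The new term adds the cross term
  \<open>2 * c * (- 1 / a)\<close> and the square \<open>c\<^sup>2 * (1/2)\<close>, which together
  lower the integral by \<open>1 / (2 * pi\<^sup>2 * (N + 1)\<^sup>2)\<close>. The initial 1/12 is
  the integral of \<open>(s - 1/2)\<^sup>2\<close>.\<close>

lemma has_integral_fourier_remainder_sq:
  "((\<lambda>s. (s - 1/2 + fourier_poly N s)\<^sup>2) has_integral
      (1/12 - (\<Sum>h=1..N. 1 / (real h)\<^sup>2) / (2 * pi\<^sup>2))) {0..1}"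
proof (induction N)
  case 0
  have "((\<lambda>s. (s - 1/2)\<^sup>2) has_integral (1 - 1/2) ^ 3 / 3 - (0 - 1/2) ^ 3 / 3) {0..1::real}"
    by (rule fundamental_theorem_of_calculus[where f = "\<lambda>s. (s - 1/2) ^ 3 / 3"])
       (auto intro!: derivative_eq_intros simp flip: has_real_derivative_iff_has_vector_derivative)
  thus ?case by (simp add: fourier_poly_def power3_eq_cube)
next
  case (Suc N)
  define a where "a = 2 * real (Suc N) * pi"
  define c where "c = 1 / (pi * real (Suc N))"
  let ?g = "\<lambda>s. s - 1/2 + fourier_poly N s"
  have a0: "a \<noteq> 0" by (simp add: a_def)
  have 1: "((\<lambda>s. ?g s * sin (a * s)) has_integral (- 1 / a)) {0..1}"
    using has_integral_linear_fourier_mult_sin[of N "Suc N"] by (simp add: a_def)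
  have "sin (2 * a) = 0" using sin_2npi[of "2 * Suc N"] by (simp add: a_def algebra_simps)
  hence 2: "((\<lambda>s. (sin (a * s))\<^sup>2) has_integral 1/2) {0..1}"
    using has_integral_sin_squared[of 0 1 a] a0 by simp
  have "((\<lambda>s. (?g s)\<^sup>2 + (2 * c * (?g s * sin (a * s)) + c\<^sup>2 * (sin (a * s))\<^sup>2)) has_integral
      ((1/12 - (\<Sum>h=1..N. 1 / (real h)\<^sup>2) / (2 * pi\<^sup>2)) + (2 * c * (- 1 / a) + c\<^sup>2 * (1/2)))) {0..1}"
    by (intro has_integral_add has_integral_mult_right 1 2 Suc)
  also have "(\<lambda>s. (?g s)\<^sup>2 + (2 * c * (?g s * sin (a * s)) + c\<^sup>2 * (sin (a * s))\<^sup>2)) =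
      (\<lambda>s. (s - 1/2 + fourier_poly (Suc N) s)\<^sup>2)"
  proof
    fix s
    have "fourier_poly (Suc N) s = fourier_poly N s + c * sin (a * s)"
      by (simp add: fourier_poly_def c_def a_def)
    thus "(?g s)\<^sup>2 + (2 * c * (?g s * sin (a * s)) + c\<^sup>2 * (sin (a * s))\<^sup>2) = (s - 1/2 + fourier_poly (Suc N) s)\<^sup>2"
      by (simp only:) (simp add: power2_eq_square algebra_simps)
  qed
  also have "2 * c * (- 1 / a) + c\<^sup>2 * (1/2) = - (1 / (real (Suc N))\<^sup>2) / (2 * pi\<^sup>2)"
    by (simp add: a_def c_def power2_eq_square divide_simps del: of_nat_Suc)
  finally show ?case by (simp add: add_divide_distrib algebra_simps)
qed

text \<open>The sequence \<open>s n + 1 / n\<close> is nonincreasing, since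
  \<open>1 / (n + 1)\<^sup>2\<close> is at most \<open>1 / n - 1 / (n + 1)\<close>, and it tends to
  the Basel value. That value cancels the 1/12 in the Bessel identity, so the mean square of the
  truncation error is O(1/N).\<close>

lemma sum_inverse_squares_ge:
  assumes "N \<ge> 1"
  shows "(\<Sum>h=1..N. 1 / (real h)\<^sup>2) \<ge> pi\<^sup>2 / 6 - 1 / real N"
proof -
  define s where "s = (\<lambda>n::nat. (\<Sum>h=1..n. 1 / (real h)\<^sup>2))"
  have decrease: "s (Suc n) + 1 / real (Suc n) \<le> s n + 1 / real n" if "n \<ge> 1" for n
  proof -
    have "1 / (real (Suc n))\<^sup>2 \<le> 1 / (real n * real (Suc n))"
      using that unfolding power2_eq_square by (intro frac_le mult_right_mono) auto
    also have "\<dots> = 1 / real n - 1 / real (Suc n)" using that by (simp add: field_simps)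
    finally show ?thesis by (simp add: s_def)
  qed
  have dec: "s n + 1 / real n \<le> s N + 1 / real N" if "n \<ge> N" for n
    using that
  proof (induction n rule: dec_induct)
    case (step n)
    thus ?case using step(1,3) assms decrease[of n] by simp
  qed simp
  have "(\<lambda>n. \<Sum>k<n. 1 / (1 + real k)\<^sup>2) \<longlonglongrightarrow> pi\<^sup>2 / 6"
    using inverse_squares_sums by (simp add: sums_def add.commute)
  also have "(\<lambda>n. \<Sum>k<n. 1 / (1 + real k)\<^sup>2) = s"
  proof
    fix n show "(\<Sum>k<n. 1 / (1 + real k)\<^sup>2) = s n"
      by (induction n) (simp_all add: s_def add.commute)
  qed
  finally have "s \<longlonglongrightarrow> pi\<^sup>2 / 6" .
  hence "pi\<^sup>2 / 6 \<le> s N + 1 / real N"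
  proof (rule LIMSEQ_le_const2)
    show "\<exists>M. \<forall>n\<ge>M. s n \<le> s N + 1 / real N"
    proof (intro exI allI impI)
      fix n assume "n \<ge> N"
      thus "s n \<le> s N + 1 / real N" using dec[of n] by (smt (verit) divide_nonneg_nonneg of_nat_0_le_iff)
    qed
  qed
  thus ?thesis by (simp add: s_def)
qed

text \<open>The sign is plus because \<open>fourier_poly N\<close> is minus the partial sum of the
  Fourier series of \<open>saw\<close>; this is the truncation error.\<close>

definition saw_rem :: "nat \<Rightarrow> real \<Rightarrow> real" where
  "saw_rem N t = saw t + fourier_poly N t"

text \<open>As a function of \<open>y\<close> the integrand has period \<open>n\<close>, and each
  full period contributes \<open>real n * E\<close>. Rounding \<open>W\<close> up to a multiple of
  \<open>n\<close> extends the interval by at most \<open>n\<close>, and the integrand is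
  nonnegative.\<close>

lemma has_integral_saw_rem_sq:
  assumes "N \<ge> 1" "n \<ge> 1" "W \<ge> 0"
  shows "\<exists>J. ((\<lambda>y. (saw_rem N (y / real n))\<^sup>2) has_integral J) {0..W} \<and> J \<le> (W + real n) / (2 * real N)"
proof -
  define E where "E = 1/12 - (\<Sum>h=1..N. 1 / (real h)\<^sup>2) / (2 * pi\<^sup>2)"
  have "E \<le> 1/12 - (pi\<^sup>2 / 6 - 1 / real N) / (2 * pi\<^sup>2)"
    unfolding E_def using sum_inverse_squares_ge[OF assms(1)]
    by (intro diff_left_mono divide_right_mono) auto
  also have "\<dots> = 1 / (2 * real N) / pi\<^sup>2" using assms(1) by (simp add: field_simps)
  also have "\<dots> \<le> 1 / (2 * real N) / 1"
    using pi_ge_two assms(1) by (intro divide_left_mono one_le_power) auto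
  finally have E: "E \<le> 1 / (2 * real N)" by simp
  let ?f = "\<lambda>y. (saw_rem N (y / real n))\<^sup>2"
  have piece: "(?f has_integral real n * E) {real (n * k)..real (n * Suc k)}" for k
  proof -
    have n: "real n > 0" using assms by simp
    have "((\<lambda>s. (s - 1/2 + fourier_poly N s)\<^sup>2) has_integral E) (cbox 0 1)"
      using has_integral_fourier_remainder_sq[of N] by (simp add: E_def)
    from has_integral_affinity'[OF this, of "1 / real n" "- real k"]
    have "((\<lambda>y. (y / real n - real k - 1/2 + fourier_poly N (y / real n - real k))\<^sup>2) has_integral real n * E)
            {real (n * k)..real (n * Suc k)}"
      using n by (simp add: algebra_simps)
    \<comment> \<open>At the right end of the period \<open>saw\<close> jumps while the shifted
      linear function does not, so this one point is excluded.\<close>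
    thus ?thesis
    proof (rule has_integral_spike_finite[where S = "{real (n * Suc k)}", rotated 2])
      fix y assume y: "y \<in> {real (n * k)..real (n * Suc k)} - {real (n * Suc k)}"
      have "real k * real n \<le> y" "y < (real k + 1) * real n" using y by (auto simp: algebra_simps)
      hence "real k \<le> y / real n" "y / real n < real k + 1"
        using n by (simp_all add: pos_le_divide_eq pos_divide_less_eq)
      hence "\<lfloor>y / real n\<rfloor> = int k" by (intro floor_unique) auto
      thus "?f y = (y / real n - real k - 1/2 + fourier_poly N (y / real n - real k))\<^sup>2"
        by (simp add: saw_rem_def saw_def frac_def fourier_poly_periodic)
    qed simp
  qed
  have whole: "(?f has_integral real K * (real n * E)) {0..real (n * K)}" for K
  proof (induction K)
    case (Suc K)
    have "(?f has_integral (real K * (real n * E) + real n * E)) {0..real (n * Suc K)}"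
      by (rule has_integral_combine[OF _ _ Suc piece]) auto
    thus ?case by (simp add: algebra_simps)
  qed (simp add: has_integral_refl)
  define K where "K = nat \<lceil>W / real n\<rceil>"
  have K: "W / real n \<le> real K" "real K \<le> W / real n + 1"
    using assms by (auto simp: K_def of_nat_nat)
  have K': "W \<le> real (n * K)" "real (n * K) \<le> W + real n" using K assms by (simp_all add: field_simps)
  have "?f integrable_on {0..W}"
    by (rule integrable_on_subinterval[OF has_integral_integrable[OF whole[of K]]]) (use K' in auto)
  then obtain J where J: "(?f has_integral J) {0..W}" by (auto simp: integrable_on_def)
  have "J \<le> real K * (real n * E)"
    by (rule has_integral_subset_le[OF _ J whole[of K]]) (use K' in auto)
  also have "\<dots> = real (n * K) * E" by simp
  also have "\<dots> \<le> real (n * K) * (1 / (2 * real N))" by (rule mult_left_mono[OF E]) simp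
  also have "\<dots> \<le> (W + real n) * (1 / (2 * real N))" by (rule mult_right_mono[OF K'(2)]) simp
  finally show ?thesis using J by auto
qed

section \<open>Harmonic sums and the mean square of the sine sums\<close>

lemma harm_mono: "m \<le> n \<Longrightarrow> harm m \<le> (harm n :: real)"
  unfolding harm_def by (intro sum_mono2) auto

lemma harm_ge_one: "n \<ge> 1 \<Longrightarrow> harm n \<ge> (1 :: real)"
  using harm_mono[of 1 n] by (simp add: harm_def)

lemma harm_le_ln: "n \<ge> 1 \<Longrightarrow> harm n \<le> 1 + ln (real n)"
  using euler_mascheroni_sequence_decreasing[of 1 n] by (simp add: harm_def)

lemma sum_inverse_distance_le:
  assumes "m \<in> {1..N}"
  shows "(\<Sum>n\<in>{1..N}-{m}. 1 / \<bar>real n - real m\<bar>) \<le> 2 * harm N"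
proof -
  have split: "{1..N} - {m} = {1..<m} \<union> {m<..N}" using assms by auto
  have left: "(\<Sum>n\<in>{1..<m}. 1 / \<bar>real n - real m\<bar>) = (\<Sum>k\<in>{1..m-1}. inverse (real k))"
  proof (rule sum.reindex_bij_witness[of _ "\<lambda>k. m - k" "\<lambda>n. m - n"])
    fix n assume "n \<in> {1..<m}"
    thus "inverse (real (m - n)) = 1 / \<bar>real n - real m\<bar>"
      by (simp add: of_nat_diff inverse_eq_divide)
  qed auto
  have right: "(\<Sum>n\<in>{m<..N}. 1 / \<bar>real n - real m\<bar>) = (\<Sum>k\<in>{1..N-m}. inverse (real k))"
  proof (rule sum.reindex_bij_witness[of _ "\<lambda>k. k + m" "\<lambda>n. n - m"])
    fix n assume "n \<in> {m<..N}"
    thus "inverse (real (n - m)) = 1 / \<bar>real n - real m\<bar>"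
      by (simp add: of_nat_diff inverse_eq_divide)
  qed auto
  have "(\<Sum>n\<in>{1..N}-{m}. 1 / \<bar>real n - real m\<bar>) =
      (\<Sum>n\<in>{1..<m}. 1 / \<bar>real n - real m\<bar>) + (\<Sum>n\<in>{m<..N}. 1 / \<bar>real n - real m\<bar>)"
    unfolding split by (rule sum.union_disjoint) auto
  also have "\<dots> = harm (m - 1) + harm (N - m)" unfolding left right harm_def ..
  also have "\<dots> \<le> 2 * harm N"
  proof -
    have "m - 1 \<le> N" "N - m \<le> N" using assms by auto
    from this[THEN harm_mono] show ?thesis by linarith
  qed
  finally show ?thesis .
qed

definition sin_sum :: "nat \<Rightarrow> real \<Rightarrow> real" where
  "sin_sum h y = (\<Sum>n=1..nat \<lfloor>sqrt y\<rfloor>. sin (2 * real h * pi * (y / real n)))"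

text \<open>The frequencies differ by 2 pi h (n - m) / (m n), which bounds the antiderivative
  \<open>F\<close> everywhere. The estimate is therefore uniform in \<open>p\<close> and
  \<open>q\<close>, as needed for intervals whose left end varies with \<open>m\<close> and
  \<open>n\<close>.\<close>

lemma has_integral_sin_pair:
  assumes "h \<ge> 1" "m \<in> {1..N}" "n \<in> {1..N}" "m \<noteq> n" "p \<le> q"
  shows "\<exists>I. ((\<lambda>y. sin (2 * real h * pi * (y / real m)) * sin (2 * real h * pi * (y / real n))) has_integral I) {p..q}
           \<and> \<bar>I\<bar> \<le> (real N)\<^sup>2 / \<bar>real n - real m\<bar>"
proof -
  define a where "a = 2 * real h * pi / real m"
  define b where "b = 2 * real h * pi / real n"
  have m: "0 < real m" "real m \<le> real N" and n: "0 < real n" "real n \<le> real N" using assms by auto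
  have pos: "a > 0" "b > 0" using assms m n by (simp_all add: a_def b_def)
  have d: "a - b = 2 * real h * pi * (real n - real m) / (real m * real n)"
    using m n by (simp add: a_def b_def field_simps)
  have ne: "a \<noteq> b"
  proof
    assume "a = b" thus False using d assms m n by simp
  qed
  define F where "F = (\<lambda>s. sin ((a - b) * s) / (2 * (a - b)) - sin ((a + b) * s) / (2 * (a + b)))"
  have F: "\<bar>F s\<bar> \<le> 1 / \<bar>a - b\<bar>" for s
  proof -
    have "\<bar>F s\<bar> \<le> \<bar>sin ((a - b) * s) / (2 * (a - b))\<bar> + \<bar>sin ((a + b) * s) / (2 * (a + b))\<bar>"
      unfolding F_def by (rule abs_triangle_ineq4)
    also have "\<dots> \<le> 1 / (2 * \<bar>a - b\<bar>) + 1 / (2 * \<bar>a - b\<bar>)"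
      unfolding abs_divide abs_mult using pos ne by (intro add_mono frac_le) (auto simp: abs_if)
    finally show ?thesis by simp
  qed
  have "\<bar>F q - F p\<bar> \<le> \<bar>F q\<bar> + \<bar>F p\<bar>" by (rule abs_triangle_ineq4)
  also have "\<dots> \<le> 2 * (1 / \<bar>a - b\<bar>)" using F[of q] F[of p] by simp
  also have "\<dots> = (real m * real n) / (real h * pi * \<bar>real n - real m\<bar>)"
    using m n by (simp add: d abs_mult)
  also have "\<dots> \<le> (real N * real N) / (1 * 1 * \<bar>real n - real m\<bar>)"
    using m n assms pi_ge_two by (intro frac_le mult_mono) auto
  finally have le: "\<bar>F q - F p\<bar> \<le> (real N)\<^sup>2 / \<bar>real n - real m\<bar>" by (simp add: power2_eq_square)
  have int: "((\<lambda>y. sin (a * y) * sin (b * y)) has_integral F q - F p) {p..q}"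
    unfolding F_def using has_integral_sin_mult_sin[OF assms(5) ne] pos by simp
  have eq: "2 * real h * pi * (y / real m) = a * y" "2 * real h * pi * (y / real n) = b * y" for y
    by (simp_all add: a_def b_def)
  show ?thesis unfolding eq using le int by blast
qed

text \<open>The summation limit depends on \<open>y\<close>, so after expanding the square the pair
  \<open>(m, n)\<close> is present only from \<open>y = p (m, n)\<close> on, the square of the
  larger index. Extended by 0 below that point its product becomes \<open>T (m, n)\<close>, and the
  sum gets a fixed range. Each diagonal pair contributes at most \<open>W\<close>; the other pairs
  with the same \<open>m\<close> contribute at most \<open>2 * (real N)\<^sup>2 * harm N\<close>,
  and the square of \<open>N\<close> is at most \<open>W\<close>.\<close>

lemma has_integral_sin_sum_sq:
  assumes "h \<ge> 1" "W \<ge> 1"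
  defines "N \<equiv> nat \<lfloor>sqrt W\<rfloor>"
  shows "\<exists>J. ((\<lambda>y. (sin_sum h y)\<^sup>2) has_integral J) {0..W} \<and> J \<le> 3 * real N * W * harm N"
proof -
  have N: "(real N)\<^sup>2 \<le> W" "N \<ge> 1"
    using le_nat_floor_sqrt_iff[of W N] le_nat_floor_sqrt_iff[of W 1] assms by auto
  let ?s = "\<lambda>n y. sin (2 * real h * pi * (y / real n))"
  define p where "p = (\<lambda>(m::nat, n::nat). (real (max m n))\<^sup>2)"
  have pW: "p mn \<le> W" if "mn \<in> {1..N} \<times> {1..N}" for mn
  proof -
    have "p mn \<le> (real N)\<^sup>2" using that by (auto simp: p_def intro!: power_mono)
    thus ?thesis using N by simp
  qed
  have "\<exists>I. case mn of (m, n) \<Rightarrow> ((\<lambda>y. ?s m y * ?s n y) has_integral I) {p mn..W}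
         \<and> \<bar>I\<bar> \<le> (if m = n then W else (real N)\<^sup>2 / \<bar>real n - real m\<bar>)"
    if mn: "mn \<in> {1..N} \<times> {1..N}" for mn
  proof -
    obtain m n where [simp]: "mn = (m, n)" by (cases mn)
    show ?thesis
    proof (cases "m = n")
      case False
      thus ?thesis using has_integral_sin_pair[of h m N n "p mn" W] assms mn pW[OF mn] by auto
    next
      case True
      have "(\<lambda>y. ?s n y * ?s n y) integrable_on {p mn..W}"
        by (intro integrable_continuous_real continuous_intros) (use mn in auto)
      then obtain I where I: "((\<lambda>y. ?s n y * ?s n y) has_integral I) {p mn..W}"
        by (auto simp: integrable_on_def)
      have "I \<ge> 0" by (rule has_integral_nonneg[OF I]) simp
      moreover have "I \<le> 1 * (W - p mn)"
      proof (rule has_integral_le[OF I])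
        show "((\<lambda>_. 1) has_integral 1 * (W - p mn)) {p mn..W}"
          using has_integral_const_real[of "1::real" "p mn" W] pW[OF mn] by simp
        show "?s n y * ?s n y \<le> 1" for y
          using abs_sin_le_one[of "2 * real h * pi * (y / real n)"]
          by (metis abs_square_le_1 power2_eq_square)
      qed
      moreover have "p mn \<ge> 0" by (cases mn) (simp add: p_def)
      ultimately show ?thesis using I True by auto
    qed
  qed
  hence "\<forall>mn\<in>{1..N} \<times> {1..N}. \<exists>I. case mn of (m, n) \<Rightarrow> ((\<lambda>y. ?s m y * ?s n y) has_integral I) {p mn..W}
         \<and> \<bar>I\<bar> \<le> (if m = n then W else (real N)\<^sup>2 / \<bar>real n - real m\<bar>)" by blast
  from bchoice[OF this] obtain I where I: "\<And>m n. (m, n) \<in> {1..N} \<times> {1..N} \<Longrightarrow>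
      ((\<lambda>y. ?s m y * ?s n y) has_integral I (m, n)) {p (m, n)..W} \<and>
      \<bar>I (m, n)\<bar> \<le> (if m = n then W else (real N)\<^sup>2 / \<bar>real n - real m\<bar>)"
    by fast
  define T where "T = (\<lambda>(m, n) y. if y \<in> {p (m, n)..W} then ?s m y * ?s n y else 0)"
  have T: "(T mn has_integral I mn) {0..W}" if mn: "mn \<in> {1..N} \<times> {1..N}" for mn
  proof -
    obtain m n where mn': "mn = (m, n)" by (cases mn)
    have "{p mn..W} \<subseteq> {0..W}" using zero_le_power2 by (auto simp: p_def mn' intro: order_trans)
    moreover have "T mn = (\<lambda>y. if y \<in> {p mn..W} then ?s m y * ?s n y else 0)"
      by (simp only: T_def mn' prod.case)
    ultimately show ?thesis using I[of m n] mn by (simp only: has_integral_restrict mn')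
  qed
  have sq: "(sin_sum h y)\<^sup>2 = (\<Sum>mn\<in>{1..N}\<times>{1..N}. T mn y)" if y: "y \<in> {0..W}" for y
  proof -
    let ?r = "nat \<lfloor>sqrt y\<rfloor>"
    have rN: "?r \<le> N" unfolding N_def using y by (intro nat_mono floor_mono real_sqrt_le_mono) auto
    have "(sin_sum h y)\<^sup>2 = (\<Sum>mn\<in>{1..?r}\<times>{1..?r}. case mn of (m, n) \<Rightarrow> ?s m y * ?s n y)"
      by (simp add: sin_sum_def power2_eq_square sum_product sum.cartesian_product)
    also have "\<dots> = (\<Sum>mn\<in>{1..N}\<times>{1..N}. T mn y)"
    proof (rule sum.mono_neutral_cong_left)
      have iff: "p (m, n) \<le> y \<longleftrightarrow> m \<le> ?r \<and> n \<le> ?r" for m n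
        using le_nat_floor_sqrt_iff[of y "max m n"] y by (simp add: p_def)
      show "\<forall>i\<in>{1..N}\<times>{1..N} - {1..?r}\<times>{1..?r}. T i y = 0"
        using iff by (auto simp: T_def split: if_splits)
      show "(case x of (m, n) \<Rightarrow> ?s m y * ?s n y) = T x y" if "x \<in> {1..?r}\<times>{1..?r}" for x
        using that iff y by (auto simp: T_def)
    qed (use rN in auto)
    finally show ?thesis .
  qed
  have "((\<lambda>y. \<Sum>mn\<in>{1..N}\<times>{1..N}. T mn y) has_integral (\<Sum>mn\<in>{1..N}\<times>{1..N}. I mn)) {0..W}"
    by (intro has_integral_sum T) auto
  hence int: "((\<lambda>y. (sin_sum h y)\<^sup>2) has_integral (\<Sum>mn\<in>{1..N}\<times>{1..N}. I mn)) {0..W}"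
    by (rule has_integral_eq[rotated]) (simp add: sq)
  have "(\<Sum>mn\<in>{1..N}\<times>{1..N}. I mn) = (\<Sum>m=1..N. \<Sum>n=1..N. I (m, n))"
    by (simp add: sum.cartesian_product)
  also have "\<dots> \<le> (\<Sum>m=1..N. W + (real N)\<^sup>2 * (2 * harm N))"
  proof (rule sum_mono)
    fix m assume m: "m \<in> {1..N}"
    have "(\<Sum>n=1..N. I (m, n)) = I (m, m) + (\<Sum>n\<in>{1..N}-{m}. I (m, n))"
      using m by (subst sum.remove[of _ m]) auto
    also have "I (m, m) \<le> W" using I[of m m] m by auto
    also have "(\<Sum>n\<in>{1..N}-{m}. I (m, n)) \<le> (\<Sum>n\<in>{1..N}-{m}. (real N)\<^sup>2 * (1 / \<bar>real n - real m\<bar>))"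
    proof (rule sum_mono)
      fix n assume "n \<in> {1..N} - {m}"
      thus "I (m, n) \<le> (real N)\<^sup>2 * (1 / \<bar>real n - real m\<bar>)" using I[of m n] m by auto
    qed
    also have "\<dots> = (real N)\<^sup>2 * (\<Sum>n\<in>{1..N}-{m}. 1 / \<bar>real n - real m\<bar>)"
      by (simp add: sum_distrib_left)
    also have "\<dots> \<le> (real N)\<^sup>2 * (2 * harm N)"
      by (intro mult_left_mono sum_inverse_distance_le m) auto
    finally show "(\<Sum>n=1..N. I (m, n)) \<le> W + (real N)\<^sup>2 * (2 * harm N)" by simp
  qed
  also have "\<dots> = real N * (W * 1 + (real N)\<^sup>2 * (2 * harm N))" by simp
  also have "\<dots> \<le> real N * (W * harm N + W * (2 * harm N))"
    using N harm_ge_one[of N] assms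
    by (intro mult_left_mono add_mono mult_right_mono) auto
  finally show ?thesis using int by (auto simp: algebra_simps)
qed

section \<open>The mean square of the sawtooth sum from its sine part and its truncation
  part\<close>

lemma saw_sum_sq_le:
  fixes W y :: real
  assumes "W \<ge> 1" "y \<in> {0..W}"
  defines "N \<equiv> nat \<lfloor>sqrt W\<rfloor>"
  shows "(saw_sum y)\<^sup>2 \<le> 2 * harm N * (\<Sum>h=1..N. 1 / real h * (sin_sum h y)\<^sup>2)
           + 2 * real N * (\<Sum>n=1..N. (saw_rem N (y / real n))\<^sup>2)"
proof -
  let ?r = "nat \<lfloor>sqrt y\<rfloor>"
  have rN: "?r \<le> N" unfolding N_def using assms by (intro nat_mono floor_mono real_sqrt_le_mono) auto
  define P where "P = (\<Sum>h=1..N. 1 / real h * sin_sum h y)"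
  \<comment> \<open>Cauchy-Schwarz over \<open>n\<close> costs a factor \<open>N\<close> for this
    part; it is regained from the mean square of each \<open>saw_rem N\<close>, which carries a
    factor 1/N.\<close>
  define R where "R = (\<Sum>n=1..?r. saw_rem N (y / real n))"
  have "(\<Sum>n=1..?r. fourier_poly N (y / real n)) = (\<Sum>n=1..?r. \<Sum>h=1..N. 1 / pi * (1 / real h * sin (2 * real h * pi * (y / real n))))"
    by (simp add: fourier_poly_def)
  also have "\<dots> = 1 / pi * P"
    unfolding P_def sin_sum_def sum_distrib_left by (rule sum.swap)
  finally have "saw_sum y = R - 1 / pi * P"
    by (simp add: saw_sum_def R_def saw_rem_def sum.distrib)
  moreover have "(R - 1 / pi * P)\<^sup>2 \<le> 2 * (1 / pi * P)\<^sup>2 + 2 * R\<^sup>2"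
    using zero_le_power2[of "R + 1 / pi * P"] unfolding power2_sum power2_diff by linarith
  moreover have "(1 / pi * P)\<^sup>2 \<le> 1 * P\<^sup>2"
    unfolding power_mult_distrib using pi_ge_two
    by (intro mult_right_mono) (auto simp: power_divide power2_eq_square intro!: mult_ge1_I)
  ultimately have 1: "(saw_sum y)\<^sup>2 \<le> 2 * P\<^sup>2 + 2 * R\<^sup>2"
    by simp
  \<comment> \<open>Cauchy--Schwarz over \<open>h\<close> leaves only products of two sines with the same \<open>h\<close>, so the cross
    terms have frequency difference proportional to \<open>h / m - h / n\<close>, which vanishes only if \<open>m = n\<close>.\<close>
  have "P\<^sup>2 = (\<Sum>h=1..N. (1 / sqrt (real h)) * (1 / sqrt (real h) * sin_sum h y))\<^sup>2"
    unfolding P_def by (intro arg_cong[of _ _ "\<lambda>x. x\<^sup>2"] sum.cong) (auto simp: field_simps)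
  also have "\<dots> \<le> (\<Sum>h=1..N. (1 / sqrt (real h))\<^sup>2) * (\<Sum>h=1..N. (1 / sqrt (real h) * sin_sum h y)\<^sup>2)"
    by (rule Cauchy_Schwarz_ineq_sum)
  also have "(\<Sum>h=1..N. (1 / sqrt (real h))\<^sup>2) = harm N"
    by (simp add: harm_def power_divide inverse_eq_divide)
  also have "(\<Sum>h=1..N. (1 / sqrt (real h) * sin_sum h y)\<^sup>2) = (\<Sum>h=1..N. 1 / real h * (sin_sum h y)\<^sup>2)"
    by (simp add: power_mult_distrib power_divide)
  finally have 2: "P\<^sup>2 \<le> harm N * (\<Sum>h=1..N. 1 / real h * (sin_sum h y)\<^sup>2)" .
  have "R\<^sup>2 \<le> (\<Sum>n=1..?r. (saw_rem N (y / real n))\<^sup>2) * real (card {1..?r})"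
    unfolding R_def by (rule sum_squared_le_sum_of_squares)
  also have "\<dots> \<le> (\<Sum>n=1..N. (saw_rem N (y / real n))\<^sup>2) * real N"
    using rN by (intro mult_mono sum_mono2 sum_nonneg) auto
  finally have 3: "R\<^sup>2 \<le> real N * (\<Sum>n=1..N. (saw_rem N (y / real n))\<^sup>2)" by (simp add: mult.commute)
  show ?thesis using 1 2 3 by linarith
qed

text \<open>The majorant \<open>B\<close> is the right-hand side of \<open>saw_sum_sq_le\<close>,
  which can be integrated term by term. The sine part gives the factor 6 and the truncation part the
  factor 2 in front of \<open>real N * W * harm N ^ 3\<close>, and \<open>N\<close> is at most
  \<open>sqrt W\<close>.\<close>

lemma saw_sum_mean_square:
  assumes "W \<ge> 1"
  shows "\<exists>B J. (B has_integral J) {0..W} \<and> (\<forall>y\<in>{0..W}. (saw_sum y)\<^sup>2 \<le> B y) \<and>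
               J \<le> 8 * (sqrt W * W) * (1 + ln W) ^ 3"
proof -
  define N where "N = nat \<lfloor>sqrt W\<rfloor>"
  have N: "(real N)\<^sup>2 \<le> W" "N \<ge> 1"
    using le_nat_floor_sqrt_iff[of W N] le_nat_floor_sqrt_iff[of W 1] assms by (auto simp: N_def)
  have "\<forall>h\<in>{1..N}. \<exists>J. ((\<lambda>y. (sin_sum h y)\<^sup>2) has_integral J) {0..W} \<and> J \<le> 3 * real N * W * harm N"
    using has_integral_sin_sum_sq[of _ W] assms by (auto simp: N_def)
  from bchoice[OF this] obtain S where S: "\<And>h. h \<in> {1..N} \<Longrightarrow> ((\<lambda>y. (sin_sum h y)\<^sup>2) has_integral S h) {0..W}"
      "\<And>h. h \<in> {1..N} \<Longrightarrow> S h \<le> 3 * real N * W * harm N"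
    by blast
  have "\<forall>n\<in>{1..N}. \<exists>J. ((\<lambda>y. (saw_rem N (y / real n))\<^sup>2) has_integral J) {0..W} \<and> J \<le> (W + real n) / (2 * real N)"
    using has_integral_saw_rem_sq[of N _ W] assms N by auto
  from bchoice[OF this] obtain R where R: "\<And>n. n \<in> {1..N} \<Longrightarrow> ((\<lambda>y. (saw_rem N (y / real n))\<^sup>2) has_integral R n) {0..W}"
      "\<And>n. n \<in> {1..N} \<Longrightarrow> R n \<le> (W + real n) / (2 * real N)"
    by blast
  define J where "J = 2 * harm N * (\<Sum>h=1..N. 1 / real h * S h) + 2 * real N * (\<Sum>n=1..N. R n)"
  let ?B = "\<lambda>y. 2 * harm N * (\<Sum>h=1..N. 1 / real h * (sin_sum h y)\<^sup>2)
           + 2 * real N * (\<Sum>n=1..N. (saw_rem N (y / real n))\<^sup>2)"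
  have int: "(?B has_integral J) {0..W}"
    unfolding J_def by (intro has_integral_add has_integral_mult_right has_integral_sum S R) auto
  have le: "\<forall>y\<in>{0..W}. (saw_sum y)\<^sup>2 \<le> ?B y"
    using saw_sum_sq_le[OF assms] by (auto simp: N_def)
  have H: "harm N \<ge> (1::real)" using harm_ge_one N by simp
  have "real N \<le> (real N)\<^sup>2" using N by (intro self_le_power) auto
  hence NW: "real N \<le> sqrt W" "real N \<le> W"
    using N real_le_rsqrt[of "real N" W] by linarith+
  have "(\<Sum>h=1..N. 1 / real h * S h) \<le> (\<Sum>h=1..N. 1 / real h * (3 * real N * W * harm N))"
    by (intro sum_mono mult_left_mono S) auto
  also have "\<dots> = harm N * (3 * real N * W * harm N)"
    by (simp add: harm_def sum_distrib_right divide_inverse)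
  finally have "2 * harm N * (\<Sum>h=1..N. 1 / real h * S h) \<le> 2 * harm N * (harm N * (3 * real N * W * harm N))"
    using H by (intro mult_left_mono) auto
  also have "2 * harm N * (harm N * (3 * real N * W * harm N)) = 6 * (real N * W) * harm N ^ 3"
    by (simp add: power3_eq_cube)
  finally have 1: "2 * harm N * (\<Sum>h=1..N. 1 / real h * S h) \<le> 6 * (real N * W) * harm N ^ 3" .
  have "(\<Sum>n=1..N. R n) \<le> (\<Sum>n=1..N. W / real N)"
  proof (rule sum_mono)
    fix n assume n: "n \<in> {1..N}"
    have "R n \<le> (W + real n) / (2 * real N)" using R(2) n .
    also have "\<dots> \<le> (W + W) / (2 * real N)" using n NW by (intro divide_right_mono) auto
    finally show "R n \<le> W / real N" by simp
  qed
  also have "\<dots> = W" using N by simp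
  finally have "2 * real N * (\<Sum>n=1..N. R n) \<le> 2 * real N * W" by (intro mult_left_mono) auto
  also have "\<dots> \<le> 2 * (real N * W) * harm N ^ 3"
    using mult_left_mono[OF one_le_power[OF H, of 3], of "2 * real N * W"] assms by simp
  finally have "J \<le> 8 * (real N * W) * harm N ^ 3"
    using 1 unfolding J_def by linarith
  also have "\<dots> \<le> 8 * (sqrt W * W) * (1 + ln W) ^ 3"
  proof (intro mult_mono power_mono)
    have "ln (real N) \<le> ln W" using N NW by (subst ln_le_cancel_iff) auto
    thus "harm N \<le> 1 + ln W" using harm_le_ln[of N] N by simp
  qed (use NW assms H in auto)
  finally show ?thesis using int le by blast
qed

subsection \<open>The divisor error at the points x / d\<close>

lemma divisor_main_increment:
  assumes "0 < y" "y \<le> z" "z \<le> X"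
  shows "divisor_main z - divisor_main y \<le> (z - y) * (ln X + 2)"
proof (cases "y = z")
  case False
  have "\<exists>c. y < c \<and> c < z \<and> divisor_main z - divisor_main y = (z - y) * (ln c + 2 * euler_mascheroni)"
  proof (rule MVT2)
    fix c assume "y \<le> c" "c \<le> z"
    hence "c > 0" using assms by simp
    thus "(divisor_main has_real_derivative ln c + 2 * euler_mascheroni) (at c)"
      unfolding divisor_main_def by (auto intro!: derivative_eq_intros)
  qed (use False assms in auto)
  then obtain c where c: "y < c" "c < z"
      "divisor_main z - divisor_main y = (z - y) * (ln c + 2 * euler_mascheroni)" by blast
  have "ln c \<le> ln X" using c assms by simp
  hence "ln c + 2 * euler_mascheroni \<le> ln X + 2"
    using euler_mascheroni_less_13_over_22 by linarith
  thus ?thesis unfolding c(3) using assms by (intro mult_left_mono) auto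
qed simp

text \<open>Since \<open>divisor_sum\<close> is monotone, the error can fall only as fast as the
  main term grows. Read from \<open>y\<close> to \<open>z\<close>, this makes a large positive value
  persist to the right; read from \<open>z\<close> back to \<open>y\<close>, it makes a large
  negative value persist to the left.\<close>

lemma divisor_error_persists_right:
  assumes "0 < y" "y \<le> z" "z \<le> X"
  shows "divisor_error z \<ge> divisor_error y - (z - y) * (ln X + 2)"
  using divisor_main_increment[OF assms] divisor_sum_mono[OF assms(2)]
  by (simp add: divisor_error_def)

text \<open>The error differs from \<open>- 2 * saw_sum y\<close> by at most 5, so its square is at
  most \<open>8 * (saw_sum y)\<^sup>2 + 50\<close>. The constant 114 is 8 * 8 + 50.\<close>

lemma divisor_error_mean_square:
  assumes "W \<ge> 1"
  shows "\<exists>B J. (B has_integral J) {0..W} \<and> (\<forall>y\<in>{0..W}. 0 \<le> B y) \<and>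
               (\<forall>y\<in>{0<..W}. (divisor_error y)\<^sup>2 \<le> B y) \<and>
               J \<le> 114 * (sqrt W * W) * (1 + ln W) ^ 3"
proof -
  obtain B J where B: "(B has_integral J) {0..W}" "\<And>y. y \<in> {0..W} \<Longrightarrow> (saw_sum y)\<^sup>2 \<le> B y"
      "J \<le> 8 * (sqrt W * W) * (1 + ln W) ^ 3"
    using saw_sum_mean_square[OF assms] by blast
  have B0: "0 \<le> B y" if "y \<in> {0..W}" for y
    using B(2)[OF that] zero_le_power2[of "saw_sum y"] by linarith
  have int: "((\<lambda>y. 8 * B y + 50) has_integral 8 * J + 50 * W) {0..W}"
    using has_integral_add[OF has_integral_mult_right[OF B(1), of 8] has_integral_const_real[of 50 0 W]] assms
    by (simp add: mult.commute)
  have sq: "(divisor_error y)\<^sup>2 \<le> 8 * B y + 50" if y: "y \<in> {0<..W}" for y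
  proof -
    define e where "e = divisor_error y + 2 * saw_sum y"
    have "e\<^sup>2 \<le> 5\<^sup>2" using divisor_error_saw_sum[of y] y abs_le_square_iff[of e 5] by (simp add: e_def)
    moreover have "(divisor_error y)\<^sup>2 = (e - 2 * saw_sum y)\<^sup>2" by (simp add: e_def)
    moreover have "(e - 2 * saw_sum y)\<^sup>2 \<le> 2 * e\<^sup>2 + 8 * (saw_sum y)\<^sup>2"
      using zero_le_power2[of "e + 2 * saw_sum y"] unfolding power2_sum power2_diff power_mult_distrib by simp
    ultimately show ?thesis using B(2)[of y] y by simp
  qed
  have "50 * W \<le> 50 * (sqrt W * W) * (1 + ln W) ^ 3"
  proof -
    have "1 * W \<le> sqrt W * W" using assms by (intro mult_right_mono) auto
    moreover have "(sqrt W * W) * 1 \<le> (sqrt W * W) * (1 + ln W) ^ 3"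
      using assms by (intro mult_left_mono one_le_power) auto
    ultimately show ?thesis by simp
  qed
  hence "8 * J + 50 * W \<le> 114 * (sqrt W * W) * (1 + ln W) ^ 3" using B(3) by simp
  thus ?thesis using int sq B0 by (intro exI[of _ "\<lambda>y. 8 * B y + 50"] exI[of _ "8 * J + 50 * W"]) auto
qed

text \<open>With \<open>x = t ^ 14\<close> all the exponents of \<open>x\<close> that occur, such as \<open>3/7\<close> and \<open>4/7\<close>, are integral in \<open>t\<close>.\<close>

lemma divisor_error_block:
  fixes t :: real and D :: nat
  assumes "t \<ge> 1" "D \<ge> 1" "real D \<le> 2 * t ^ 6"
  shows "(\<Sum>d=D..<2*D. \<bar>divisor_error (t ^ 14 / real d)\<bar>) \<le> 60000 * (ln (t ^ 14) + 3) ^ 4 * t ^ 8"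
proof -
  define x where "x = t ^ 14"
  define l where "l = ln x + 3"
  define \<delta> where "\<delta> = real D"
  \<comment> \<open>Values up to the threshold \<open>V\<close> contribute at most
    \<open>\<delta> * V = t ^ 8\<close> over the block. On an interval of length \<open>L\<close> a
    drift of slope at most \<open>l\<close> stays within \<open>V / 16\<close>, and \<open>W\<close>
    leaves room for such intervals around all points \<open>x / d\<close> of the block.\<close>
  define V where "V = t ^ 8 / \<delta>"
  define L where "L = V / (16 * l)"
  define W where "W = 2 * x / \<delta>"
  define e where "e = (\<lambda>d::nat. divisor_error (x / real d))"
  have t: "t > 0" using assms by simp
  have x: "x \<ge> 1" "x > 0" using assms by (auto simp: x_def)
  have l: "l \<ge> 3" using x by (simp add: l_def)
  have \<delta>: "\<delta> \<ge> 1" "\<delta> > 0" "\<delta> \<le> 2 * t ^ 6" using assms by (auto simp: \<delta>_def)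
  have V: "V > 0" using t \<delta> by (simp add: V_def)
  have L: "L > 0" "L \<le> V / 48" "L * l = V / 16" using V l by (auto simp: L_def field_simps)
  have xV: "x / \<delta> = V * t ^ 6" by (simp add: V_def x_def flip: power_add)
  have "V * 1 \<le> V * t ^ 6" using V assms by (intro mult_left_mono one_le_power) auto
  hence Vx: "V \<le> x / \<delta>" using xV by simp
  have xdx: "x / \<delta> \<le> x" using x \<delta> by (simp add: field_simps)
  have W1: "W \<ge> 1"
  proof -
    have "\<delta> \<le> 2 * t ^ 14" using \<delta>(3) power_increasing[of 6 14 t] assms(1) by linarith
    thus ?thesis using \<delta> by (simp add: W_def x_def)
  qed
  have yd: "x / (2 * \<delta>) \<le> x / real d" "x / real d \<le> x / \<delta>" if "d \<in> {D..<2*D}" for d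
    using that assms x by (auto simp: \<delta>_def intro!: divide_left_mono)
  \<comment> \<open>Neighbouring points are at least \<open>x / (4 * \<delta> * \<delta>)\<close>
    apart. This is at least \<open>V / 8\<close> precisely because
    \<open>\<delta> \<le> 2 * t ^ 6\<close>, whereas \<open>2 * L\<close> is at most
    \<open>V / 24\<close>.\<close>
  have sep: "x / real d - x / real d' > 2 * L" if "d \<in> {D..<2*D}" "d' \<in> {D..<2*D}" "d < d'" for d d'
  proof -
    have d: "real d \<ge> 1" "real d + 1 \<le> 2 * \<delta>" "real d + 1 \<le> real d'" using that assms by (auto simp: \<delta>_def)
    have "V / 8 \<le> x / (4 * \<delta> * \<delta>)"
    proof -
      have "V / 8 = V * \<delta> / (8 * \<delta>)" using \<delta> by simp
      also have "\<dots> \<le> V * (2 * t ^ 6) / (8 * \<delta>)" using \<delta> V by (intro divide_right_mono mult_left_mono) auto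
      also have "\<dots> = (V * t ^ 6) / (4 * \<delta>)" by simp
      also have "\<dots> = x / (4 * \<delta> * \<delta>)" by (simp flip: xV)
      finally show ?thesis .
    qed
    also have "\<dots> \<le> x / (real d * (real d + 1))"
    proof (rule divide_left_mono)
      have "real d * (real d + 1) \<le> (2 * \<delta>) * (2 * \<delta>)" using d by (intro mult_mono) auto
      thus "real d * (real d + 1) \<le> 4 * \<delta> * \<delta>" by simp
    qed (use x d \<delta> in auto)
    also have "\<dots> = x / real d - x / (real d + 1)" using d by (simp add: field_simps)
    also have "\<dots> \<le> x / real d - x / real d'" using d x by (intro diff_left_mono divide_left_mono) auto
    finally show ?thesis using L V by linarith
  qed
  define bad where "bad = {d \<in> {D..<2*D}. \<bar>e d\<bar> > V}"
  \<comment> \<open>The interval lies on the side on which a value of the given sign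
    persists.\<close>
  define I where "I = (\<lambda>d. if e d > 0 then {x / real d..x / real d + L} else {x / real d - L..x / real d})"
  have I_near: "\<bar>y - x / real d\<bar> \<le> L" if "y \<in> I d" for d y
    using that L by (auto simp: I_def split: if_splits)
  have disj: "d = d'" if "d \<in> bad" "d' \<in> bad" "y \<in> I d" "y \<in> I d'" for d d' y
  proof (rule ccontr)
    assume "d \<noteq> d'"
    hence "\<bar>x / real d - x / real d'\<bar> > 2 * L"
      using sep[of d d'] sep[of d' d] that(1,2) by (cases "d < d'") (auto simp: bad_def)
    thus False using I_near[OF that(3)] I_near[OF that(4)] by linarith
  qed
  have I_sub: "I d \<subseteq> {0<..W}" if "d \<in> bad" for d
  proof
    fix y assume "y \<in> I d"
    moreover have "d \<in> {D..<2*D}" using that by (simp add: bad_def)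
    moreover have "W = 2 * (x / \<delta>)" "x / (2 * \<delta>) = (x / \<delta>) / 2" by (simp_all add: W_def)
    moreover have "x / \<delta> > 0" using x \<delta> by simp
    ultimately show "y \<in> {0<..W}"
      using I_near[of y d] yd[of d] L(2) V Vx by auto
  qed
  \<comment> \<open>The drift along \<open>I d\<close> is at most \<open>V / 16\<close>, less than
    half of \<open>\<bar>e d\<bar>\<close>, so at least half of the value remains; squaring gives
    the factor 1/4.\<close>
  have big: "(e d)\<^sup>2 / 4 \<le> (divisor_error y)\<^sup>2" if d: "d \<in> bad" and y: "y \<in> I d" for d y
  proof -
    have ln2x: "ln (2 * x) + 2 \<le> l" using x ln_2_less_1 by (simp add: l_def ln_mult)
    have dD: "d \<in> {D..<2*D}" and eV: "\<bar>e d\<bar> > V" using d by (simp_all add: bad_def)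
    have pos: "x / real d > 0" "y > 0" using dD assms x I_sub[OF d] y by auto
    have up: "x / real d \<le> 2 * x" "y \<le> 2 * x"
      using yd[OF dD] xdx x I_sub[OF d] y by (auto simp: W_def)
    have small: "r * (ln (2 * x) + 2) \<le> V / 16" if "0 \<le> r" "r \<le> L" for r
    proof -
      have "r * (ln (2 * x) + 2) \<le> L * l" using that ln2x x by (intro mult_mono) auto
      thus ?thesis using L by simp
    qed
    have "\<bar>e d / 2\<bar> \<le> \<bar>divisor_error y\<bar>"
    proof (cases "e d > 0")
      case True
      hence yI: "x / real d \<le> y" "y - x / real d \<le> L" using y by (auto simp: I_def)
      show ?thesis
        using divisor_error_persists_right[OF pos(1) yI(1) up(2)] small[of "y - x / real d"] yI True eV V
        by (simp add: e_def)
    next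
      case False
      hence yI: "y \<le> x / real d" "x / real d - y \<le> L" using y by (auto simp: I_def)
      show ?thesis
        using divisor_error_persists_right[OF pos(2) yI(1) up(1)] small[of "x / real d - y"] yI False eV V
        by (simp add: e_def)
    qed
    hence "(e d / 2)\<^sup>2 \<le> (divisor_error y)\<^sup>2" by (simp only: abs_le_square_iff)
    thus ?thesis by (simp add: power_divide)
  qed
  \<comment> \<open>By \<open>disj\<close> at most one interval contains a given \<open>y\<close>,
    so the sum of the step functions of height \<open>(e d)\<^sup>2 / 4\<close> on
    \<open>I d\<close> lies below \<open>B\<close>. Integration then bounds the second moment over
    \<open>bad\<close> by \<open>J\<close>.\<close>
  obtain B J where B: "(B has_integral J) {0..W}" "\<And>y. y \<in> {0..W} \<Longrightarrow> 0 \<le> B y"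
      "\<And>y. y \<in> {0<..W} \<Longrightarrow> (divisor_error y)\<^sup>2 \<le> B y" "J \<le> 114 * (sqrt W * W) * (1 + ln W) ^ 3"
    using divisor_error_mean_square[OF W1] by blast
  have "(\<Sum>d\<in>bad. (e d)\<^sup>2 / 4 * L) \<le> J"
  proof (rule has_integral_le[OF has_integral_sum B(1)])
    fix d assume d: "d \<in> bad"
    have "((\<lambda>_. (e d)\<^sup>2 / 4) has_integral (e d)\<^sup>2 / 4 * L) (I d)"
      using has_integral_const_real[of "(e d)\<^sup>2 / 4" "x / real d" "x / real d + L"]
        has_integral_const_real[of "(e d)\<^sup>2 / 4" "x / real d - L" "x / real d"] L
      by (simp add: I_def mult.commute)
    moreover have "I d \<subseteq> {0..W}" using I_sub[OF d] by auto
    ultimately show "((\<lambda>y. if y \<in> I d then (e d)\<^sup>2 / 4 else 0) has_integral (e d)\<^sup>2 / 4 * L) {0..W}"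
      by simp
  next
    fix y assume y: "y \<in> {0..W}"
    show "(\<Sum>d\<in>bad. if y \<in> I d then (e d)\<^sup>2 / 4 else 0) \<le> B y"
    proof (cases "\<exists>d\<in>bad. y \<in> I d")
      case True
      then obtain d where d: "d \<in> bad" "y \<in> I d" by blast
      have "(\<Sum>d'\<in>bad. if y \<in> I d' then (e d')\<^sup>2 / 4 else 0) = (\<Sum>d'\<in>bad. if d' = d then (e d')\<^sup>2 / 4 else 0)"
        using disj d by (intro sum.cong) auto
      also have "\<dots> = (e d)\<^sup>2 / 4" using d by (simp add: bad_def)
      also have "\<dots> \<le> B y" using big[OF d] B(3)[of y] I_sub[OF d(1)] d(2) by fastforce
      finally show ?thesis .
    next
      case False
      hence "(\<Sum>d\<in>bad. if y \<in> I d then (e d)\<^sup>2 / 4 else 0) = 0" by (intro sum.neutral) auto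
      thus ?thesis using B(2)[OF y] by simp
    qed
  qed (simp add: bad_def)
  also note B(4)
  also have "114 * (sqrt W * W) * (1 + ln W) ^ 3 \<le> 114 * (4 * t ^ 21 / (sqrt \<delta> * \<delta>)) * l ^ 3"
  proof (intro mult_mono power_mono)
    have "sqrt x = t ^ 7"
      using t by (intro real_sqrt_unique) (auto simp: x_def simp flip: power_mult)
    moreover have "sqrt 2 \<le> 2" by (rule real_le_lsqrt) auto
    ultimately have "sqrt W \<le> 2 * t ^ 7 / sqrt \<delta>" using t \<delta>
      by (simp add: W_def real_sqrt_divide real_sqrt_mult divide_right_mono)
    hence "sqrt W * W \<le> (2 * t ^ 7 / sqrt \<delta>) * (2 * t ^ 14 / \<delta>)"
      unfolding W_def x_def using t \<delta> by (intro mult_mono) auto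
    also have "\<dots> = 4 * t ^ 21 / (sqrt \<delta> * \<delta>)" by (simp flip: power_add)
    finally show "sqrt W * W \<le> 4 * t ^ 21 / (sqrt \<delta> * \<delta>)" .
    have "ln W \<le> ln (2 * x)" using W1 xdx x by (subst ln_le_cancel_iff) (auto simp: W_def)
    thus "1 + ln W \<le> l" using x ln_2_less_1 by (simp add: l_def ln_mult)
  qed (use W1 \<delta> l t in auto)
  finally have sum_sq: "(\<Sum>d\<in>bad. (e d)\<^sup>2 / 4 * L) \<le> 114 * (4 * t ^ 21 / (sqrt \<delta> * \<delta>)) * l ^ 3" .
  have "(\<Sum>d\<in>bad. \<bar>e d\<bar>) \<le> (\<Sum>d\<in>bad. 4 / (L * V) * ((e d)\<^sup>2 / 4 * L))"
  proof (rule sum_mono)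
    \<comment> \<open>Chebyshev's device: above the threshold, a first power is at most the square
      divided by \<open>V\<close>.\<close>
    fix d assume "d \<in> bad"
    hence "V * \<bar>e d\<bar> \<le> \<bar>e d\<bar> * \<bar>e d\<bar>" by (intro mult_right_mono) (auto simp: bad_def)
    hence "\<bar>e d\<bar> \<le> (e d)\<^sup>2 / V" using V by (simp add: field_simps power2_eq_square)
    also have "\<dots> = 4 / (L * V) * ((e d)\<^sup>2 / 4 * L)" using L V by simp
    finally show "\<bar>e d\<bar> \<le> 4 / (L * V) * ((e d)\<^sup>2 / 4 * L)" .
  qed
  also have "\<dots> = 4 / (L * V) * (\<Sum>d\<in>bad. (e d)\<^sup>2 / 4 * L)" by (simp add: sum_distrib_left)
  also have "\<dots> \<le> 4 / (L * V) * (114 * (4 * t ^ 21 / (sqrt \<delta> * \<delta>)) * l ^ 3)"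
    using sum_sq L V by (intro mult_left_mono) auto
  \<comment> \<open>The constant is 64 * 114 * 4. The result grows like the square root of
    \<open>\<delta>\<close> and reaches the order \<open>t ^ 8\<close> of the values below the
    threshold when \<open>\<delta>\<close> is of order \<open>t ^ 6\<close>.\<close>
  also have "\<dots> = 29184 * l ^ 4 * (t ^ 5 * sqrt \<delta>)"
  proof -
    define s where "s = sqrt \<delta>"
    have s: "s > 0" "\<delta> = s * s" using \<delta> by (simp_all add: s_def)
    have "4 / (L * V) = 64 * l * \<delta> ^ 2 / t ^ 16"
      using l t \<delta> by (simp add: L_def V_def power2_eq_square field_simps flip: power_add)
    moreover have "t ^ 21 = t ^ 5 * t ^ 16" "l ^ 4 = l * l ^ 3" by (simp_all flip: power_add power_Suc)
    moreover have "64 * l * (s * s)\<^sup>2 / p * (114 * (4 * (q * p) / (s * (s * s))) * r) = 29184 * (l * r) * (q * s)"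
      if "p > 0" for p q r :: real
      using that s(1) by (simp add: field_simps power2_eq_square)
    ultimately show ?thesis unfolding s_def[symmetric] using t by (simp only: s(2) zero_less_power)
  qed
  also have "\<dots> \<le> 29184 * l ^ 4 * (t ^ 5 * (2 * t ^ 3))"
  proof -
    have "(2 * t ^ 3)\<^sup>2 = 4 * t ^ 6" by (simp add: power_mult_distrib flip: power_mult)
    moreover have "0 \<le> t ^ 6" using t by simp
    ultimately have "\<delta> \<le> (2 * t ^ 3)\<^sup>2" using \<delta>(3) by linarith
    hence "sqrt \<delta> \<le> 2 * t ^ 3" using t by (intro real_le_lsqrt) (use \<delta> in auto)
    thus ?thesis using t l by (intro mult_left_mono) auto
  qed
  also have "\<dots> = 58368 * l ^ 4 * t ^ 8" by (simp flip: power_add)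
  finally have bad_sum: "(\<Sum>d\<in>bad. \<bar>e d\<bar>) \<le> 58368 * l ^ 4 * t ^ 8" .
  have "(\<Sum>d\<in>{D..<2*D}-bad. \<bar>e d\<bar>) \<le> of_nat (card ({D..<2*D}-bad)) * V"
    by (rule sum_bounded_above) (auto simp: bad_def)
  also have "\<dots> \<le> \<delta> * V"
  proof (rule mult_right_mono)
    have "card ({D..<2*D}-bad) \<le> card {D..<2*D}" by (intro card_mono) auto
    thus "real (card ({D..<2*D}-bad)) \<le> \<delta>" by (simp add: \<delta>_def)
  qed (use V in simp)
  also have "\<dots> = 1 * t ^ 8" using \<delta> by (simp add: V_def)
  also have "\<dots> \<le> l ^ 4 * t ^ 8" using l t by (intro mult_right_mono one_le_power) auto
  finally have good_sum: "(\<Sum>d\<in>{D..<2*D}-bad. \<bar>e d\<bar>) \<le> l ^ 4 * t ^ 8" .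
  have "(\<Sum>d=D..<2*D. \<bar>e d\<bar>) = (\<Sum>d\<in>{D..<2*D}-bad. \<bar>e d\<bar>) + (\<Sum>d\<in>bad. \<bar>e d\<bar>)"
    by (rule sum.subset_diff) (auto simp: bad_def)
  also have "\<dots> \<le> 60000 * (l ^ 4 * t ^ 8)"
  proof -
    have "0 \<le> l ^ 4 * t ^ 8" using l t by simp
    thus ?thesis using bad_sum good_sum by linarith
  qed
  finally show ?thesis by (simp add: e_def l_def x_def)
qed

text \<open>Dyadic blocks. The last one may run past \<open>m\<close>, but the block bound restricts
  only its starting point, which is at most \<open>m\<close>. There are at most \<open>2 * l\<close>
  blocks, which accounts for the extra logarithm.\<close>

lemma sum_divisor_error:
  fixes t :: real and m :: nat
  assumes "t \<ge> 1" "real m \<le> 2 * t ^ 6"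
  shows "(\<Sum>d=1..m. \<bar>divisor_error (t ^ 14 / real d)\<bar>) \<le> 120000 * (ln (t ^ 14) + 3) ^ 5 * t ^ 8"
proof (cases "m = 0")
  case False
  define l where "l = ln (t ^ 14) + 3"
  define A where "A = 60000 * l ^ 4 * t ^ 8"
  let ?g = "\<lambda>d. \<bar>divisor_error (t ^ 14 / real d)\<bar>"
  have l: "l \<ge> 3" using assms by (simp add: l_def one_le_power)
  obtain J where J: "2 ^ J \<le> m" "m < 2 ^ (J + 1)"
    using ex_power_ivl1[of 2 m] False by auto
  have dyadic: "(\<Sum>d=1..<2^j. ?g d) \<le> real j * A" if "j \<le> J + 1" for j
    using that
  proof (induction j)
    case (Suc j)
    have "(2::nat) ^ j \<le> 2 ^ J" using Suc by (intro power_increasing) auto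
    hence "real (2 ^ j) \<le> 2 * t ^ 6" using J assms of_nat_mono[of "2 ^ j" m, where 'a = real] by linarith
    hence "(\<Sum>d=2^j..<2*2^j. ?g d) \<le> A"
      using divisor_error_block[of t "2 ^ j"] assms by (simp add: A_def l_def)
    moreover have "(\<Sum>d=1..<2^Suc j. ?g d) = (\<Sum>d=1..<2^j. ?g d) + (\<Sum>d=2^j..<2*2^j. ?g d)"
      by (subst sum.atLeastLessThan_concat) auto
    ultimately show ?case using Suc by (simp add: algebra_simps)
  qed simp
  have "real (J + 1) \<le> 2 * l"
  proof -
    have "(2::real) ^ J \<le> real m" using J(1) by (metis of_nat_le_iff of_nat_numeral of_nat_power)
    also have "\<dots> \<le> 2 * t ^ 14" using assms power_increasing[of 6 14 t] by linarith
    finally have "ln (2 ^ J) \<le> ln (2 * t ^ 14)" using assms by (subst ln_le_cancel_iff) auto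
    hence *: "real J * ln 2 \<le> ln 2 + ln (t ^ 14)" using assms by (simp add: ln_mult ln_realpow)
    have "real J * (1/2) \<le> real J * ln 2" using ln2_ge_two_thirds by (intro mult_left_mono) auto
    thus ?thesis using * ln_2_less_1 by (simp add: l_def)
  qed
  hence "real (J + 1) * A \<le> 2 * l * A" using l assms by (intro mult_right_mono) (auto simp: A_def)
  moreover have "(\<Sum>d=1..m. ?g d) \<le> (\<Sum>d=1..<2^(J+1). ?g d)" using J by (intro sum_mono2) auto
  ultimately have "(\<Sum>d=1..m. ?g d) \<le> 2 * l * A" using dyadic[of "J + 1"] by linarith
  also have "\<dots> = 120000 * l ^ 5 * t ^ 8" by (simp add: A_def eval_nat_numeral)
  finally show ?thesis by (simp add: l_def)
qed (use assms in \<open>auto intro!: mult_nonneg_nonneg zero_le_power add_nonneg_nonneg simp: one_le_power\<close>)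

subsection \<open>The asymptotic formula\<close>

text \<open>The quotient has floor \<open>d\<close> exactly when the product of the pair lies above
  \<open>x / (d + 1)\<close> and not above \<open>x / d\<close>. The induction peels off these
  layers one at a time, leaving the pairs with quotient above \<open>N\<close>.\<close>

lemma sum_hyp_pairs_by_quotient:
  fixes f :: "nat \<Rightarrow> complex"
  assumes "x > 0"
  defines "F \<equiv> \<lambda>p. f (nat \<lfloor>x / real (fst p * snd p)\<rfloor>)"
  shows "(\<Sum>p\<in>hyp_pairs x. F p) = (\<Sum>p\<in>hyp_pairs (x / real (Suc N)). F p)
           + (\<Sum>d=1..N. f d * of_real (real (divisor_sum (x / real d)) - real (divisor_sum (x / real (Suc d)))))"
proof (induction N)
  case (Suc N)
  let ?A = "hyp_pairs (x / real (Suc N))" and ?B = "hyp_pairs (x / real (Suc (Suc N)))"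
  have sub: "?B \<subseteq> ?A" using assms by (intro hyp_pairs_mono divide_left_mono) auto
  have "F p = f (Suc N)" if p: "p \<in> ?A - ?B" for p
  proof -
    obtain a b where [simp]: "p = (a, b)" by (cases p)
    define q where "q = real (a * b)"
    have q: "q > 0" "q \<le> x / real (Suc N)" "x / real (Suc (Suc N)) < q"
      using p by (auto simp: q_def hyp_pairs_def)
    hence "real (Suc N) \<le> x / q" "x / q < real (Suc N) + 1"
      by (simp_all add: pos_le_divide_eq pos_divide_less_eq mult.commute)
    hence "\<lfloor>x / q\<rfloor> = int (Suc N)" by (intro floor_unique) simp_all
    hence "nat \<lfloor>x / real (fst p * snd p)\<rfloor> = Suc N" by (simp add: q_def)
    thus ?thesis by (simp only: F_def)
  qed
  hence "(\<Sum>p\<in>?A - ?B. F p) = of_nat (card (?A - ?B)) * f (Suc N)" by simp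
  also have "card (?A - ?B) = divisor_sum (x / real (Suc N)) - divisor_sum (x / real (Suc (Suc N)))"
    unfolding divisor_sum_def by (rule card_Diff_subset[OF finite_hyp_pairs sub])
  finally have "(\<Sum>p\<in>?A - ?B. F p) =
      f (Suc N) * of_real (real (divisor_sum (x / real (Suc N))) - real (divisor_sum (x / real (Suc (Suc N)))))"
    using card_mono[OF finite_hyp_pairs sub] by (simp add: divisor_sum_def of_nat_diff del: of_nat_Suc)
  moreover have "(\<Sum>p\<in>?A. F p) = (\<Sum>p\<in>?A - ?B. F p) + (\<Sum>p\<in>?B. F p)"
    by (rule sum.subset_diff[OF sub finite_hyp_pairs])
  ultimately show ?case using Suc by (simp del: of_nat_Suc)
qed simp

section \<open>Reciprocal sums, tails of the two series and logarithmic estimates\<close>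

lemma sum_inverse_hyp_pairs_le:
  assumes "x \<ge> 1" "z \<le> x"
  shows "(\<Sum>p\<in>hyp_pairs z. 1 / real (fst p * snd p)) \<le> (1 + ln x)\<^sup>2"
proof -
  define r where "r = nat \<lfloor>x\<rfloor>"
  have r: "r \<ge> 1" "real r \<le> x" using assms by (simp_all add: r_def le_nat_floor)
  have "(\<Sum>p\<in>hyp_pairs z. 1 / real (fst p * snd p)) \<le> (\<Sum>p\<in>{1..r}\<times>{1..r}. 1 / real (fst p * snd p))"
    using hyp_pairs_mono[OF assms(2)] hyp_pairs_subset[of x] by (intro sum_mono2) (auto simp: r_def)
  also have "\<dots> = (harm r)\<^sup>2"
    by (simp add: harm_def power2_eq_square sum_product sum.cartesian_product case_prod_unfold inverse_eq_divide)
  also have "\<dots> \<le> (1 + ln x)\<^sup>2"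
  proof (rule power_mono)
    have "ln (real r) \<le> ln x" using r by simp
    thus "harm r \<le> 1 + ln x" using harm_le_ln[OF r(1)] by linarith
  qed (simp add: harm_nonneg)
  finally show ?thesis .
qed

text \<open>The mean value theorem makes the terms smaller than a multiple of the telescoping
  differences of \<open>(n + 1) powr (\<beta> - 1)\<close>, which also gives summability. The 2 in
  \<open>C\<close> pays for replacing \<open>r\<close> by \<open>(r + 1) / 2\<close> in the
  denominator. A general \<open>\<beta>\<close> allows the logarithm in \<open>C3\<close> to be
  absorbed into the exponent.\<close>

lemma tail_bound:
  fixes a :: "nat \<Rightarrow> complex"
  assumes "0 \<le> \<beta>" "\<beta> < 1" "c \<ge> 0"
    and a: "\<And>n. norm (a n) \<le> c * real (n + 1) powr \<beta> / (real (n + 1) * real (n + 2))"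
  shows "norm (suminf a - (\<Sum>n<N. a n)) \<le> 2 * c / (1 - \<beta>) * real (N + 1) powr (\<beta> - 1)"
proof -
  define b where "b = (\<lambda>n. real (n + 1) powr (\<beta> - 1))"
  define C where "C = 2 * c / (1 - \<beta>)"
  have C: "C \<ge> 0" using assms by (simp add: C_def)
  have ab: "norm (a n) \<le> C * (b n - b (Suc n))" for n
  proof -
    define r where "r = real (n + 1)"
    have r: "r \<ge> 1" by (simp add: r_def)
    have "\<exists>\<xi>. r < \<xi> \<and> \<xi> < r + 1 \<and> (r + 1) powr (\<beta> - 1) - r powr (\<beta> - 1)
             = (r + 1 - r) * ((\<beta> - 1) * \<xi> powr (\<beta> - 1 - 1))"
      by (rule MVT2) (use r in \<open>auto intro!: derivative_eq_intros\<close>)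
    then obtain \<xi> where \<xi>: "r < \<xi>" "\<xi> < r + 1"
        "r powr (\<beta> - 1) - (r + 1) powr (\<beta> - 1) = (1 - \<beta>) * \<xi> powr (\<beta> - 2)"
      by (auto simp: algebra_simps)
    have "(r + 1) powr (\<beta> - 2) \<le> \<xi> powr (\<beta> - 2)" using \<xi> r assms by (intro powr_mono2') auto
    hence "(1 - \<beta>) * (r + 1) powr (\<beta> - 2) \<le> b n - b (Suc n)"
      using assms \<xi>(3) by (simp add: b_def r_def add.commute mult_left_mono)
    hence 1: "C * ((1 - \<beta>) * (r + 1) powr (\<beta> - 2)) \<le> C * (b n - b (Suc n))"
      by (rule mult_left_mono[OF _ C])
    have "r powr \<beta> \<le> (r + 1) powr \<beta>" using r assms by (intro powr_mono2) auto
    hence "c * r powr \<beta> / (r * (r + 1)) \<le> c * (r + 1) powr \<beta> / ((r + 1) / 2 * (r + 1))"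
      using r assms by (intro frac_le mult_mono) auto
    also have "\<dots> = 2 * c * (r + 1) powr (\<beta> - 2)"
      using r by (simp add: powr_diff power2_eq_square)
    also have "\<dots> = C * ((1 - \<beta>) * (r + 1) powr (\<beta> - 2))" using assms by (simp add: C_def)
    finally show ?thesis using a[of n] 1 by (simp add: r_def algebra_simps)
  qed
  have b0: "b \<longlonglongrightarrow> 0"
  proof -
    have "filterlim (\<lambda>n. real (n + 1)) at_top sequentially"
      by (rule filterlim_compose[OF filterlim_real_sequentially filterlim_add_const_nat_at_top])
    thus ?thesis unfolding b_def using assms by (intro tendsto_neg_powr) auto
  qed
  have b: "(\<lambda>n. C * (b (n + k) - b (Suc (n + k)))) sums (C * b k)" for k
    using sums_mult[OF telescope_sums'[OF LIMSEQ_ignore_initial_segment[OF b0, of k]], of C] by simp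
  have "summable a"
    by (rule summable_comparison_test'[OF sums_summable[OF b[of 0]]]) (use ab in simp)
  hence "suminf a - (\<Sum>n<N. a n) = (\<Sum>n. a (n + N))" by (simp add: suminf_minus_initial_segment)
  also have "norm \<dots> \<le> (\<Sum>n. C * (b (n + N) - b (Suc (n + N))))"
    by (rule norm_suminf_le[OF ab sums_summable[OF b]])
  also have "\<dots> = C * b N" using b[of N] by (simp add: sums_iff)
  finally show ?thesis by (simp add: C_def b_def)
qed

text \<open>Splitting \<open>ln (x / d)\<close> produces the terms of the series \<open>C1\<close>
  and \<open>C3\<close>, so summation over \<open>d\<close> yields the main terms of the
  theorem.\<close>

lemma divisor_main_diff:
  assumes "x > 0" "d \<ge> 1"
  shows "divisor_main (x / real d) - divisor_main (x / real (Suc d)) =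
           (x * ln x + (2 * euler_mascheroni - 1) * x) / (real d * real (Suc d))
           - x * (ln (real d) / real d - ln (real (Suc d)) / real (Suc d))"
proof -
  define r s where "r = real d" and "s = real (Suc d)"
  have rs: "r > 0" "s > 0" "s = r + 1" using assms by (auto simp: r_def s_def)
  have "divisor_main (x / r) - divisor_main (x / s) =
      (x * ln x + (2 * euler_mascheroni - 1) * x) * (1 / r - 1 / s) - x * (ln r / r - ln s / s)"
    using assms rs(1,2) by (simp add: divisor_main_def ln_div field_simps)
  also have "1 / r - 1 / s = 1 / (r * s)" using rs by (simp add: field_simps)
  finally show ?thesis by (simp add: r_def s_def)
qed

lemma abs_ln_quotient_diff_le:
  assumes "d \<ge> 1"
  shows "\<bar>ln (real d) / real d - ln (real (Suc d)) / real (Suc d)\<bar> \<le> (1 + ln (real d)) / (real d * real (Suc d))"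
proof -
  define r where "r = real d"
  have r: "r \<ge> 1" using assms by (simp add: r_def)
  have "r * (1 + 1 / r) = r + 1" using r by (simp add: field_simps)
  hence "ln (r + 1) = ln (r * (1 + 1 / r))" by simp
  also have "\<dots> = ln r + ln (1 + 1 / r)" using r by (intro ln_mult_pos) (auto intro: add_pos_nonneg)
  finally have ln1: "ln (r + 1) = ln r + ln (1 + 1 / r)" .
  have "ln (1 + 1 / r) \<le> 1 / r" using r by (intro ln_add_one_self_le_self) auto
  hence u: "r * ln (1 + 1 / r) \<le> 1" using r by (simp add: field_simps)
  have v: "0 \<le> r * ln (1 + 1 / r)" "0 \<le> ln r" using r by simp_all
  have "ln r / r - ln (r + 1) / (r + 1) = (ln r - r * ln (1 + 1 / r)) / (r * (r + 1))"
    unfolding ln1 using r by (simp add: field_simps)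
  moreover have "\<bar>ln r - r * ln (1 + 1 / r)\<bar> \<le> 1 + ln r" using u v by linarith
  ultimately have "\<bar>ln r / r - ln (r + 1) / (r + 1)\<bar> \<le> (1 + ln r) / (r * (r + 1))"
    using r by (simp add: divide_right_mono)
  thus ?thesis by (simp add: r_def add.commute)
qed

lemma ln_power_le_powr:
  fixes c \<delta> :: real
  assumes "x \<ge> 1" "\<delta> > 0" "c \<ge> 0"
  shows "(ln x + c) ^ k \<le> (1 / \<delta> + c) ^ k * x powr (\<delta> * real k)"
proof -
  have "1 \<le> x powr \<delta>" using assms by (intro ge_one_powr_ge_zero) auto
  hence "c * 1 \<le> c * x powr \<delta>" using assms by (intro mult_left_mono)
  hence "ln x + c \<le> (1 / \<delta> + c) * x powr \<delta>"
    using ln_powr_bound[OF assms(1,2)] by (simp add: algebra_simps)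
  hence "(ln x + c) ^ k \<le> ((1 / \<delta> + c) * x powr \<delta>) ^ k"
    using assms by (intro power_mono) auto
  thus ?thesis using assms by (simp add: power_mult_distrib powr_realpow' powr_powr flip: powr_realpow)
qed

text \<open>Here the product \<open>q\<close> of a pair is at most \<open>t ^ 8\<close>. Writing
  \<open>(x / q) powr \<alpha>\<close> as \<open>x powr \<alpha> * q powr (1 - \<alpha>) / q\<close>
  and bounding the middle factor gives the exponent 14 \<alpha> + 8 (1 - \<alpha>); the remaining
  sum of \<open>1 / q\<close> costs two logarithms.\<close>

lemma small_quotient_part_bound:
  fixes f :: "nat \<Rightarrow> complex"
  assumes "0 \<le> \<alpha>" "\<alpha> < 1" "M \<ge> 0" and f: "\<And>n. n \<ge> 1 \<Longrightarrow> norm (f n) \<le> M * real n powr \<alpha>"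
    and "t \<ge> 1" "z \<le> t ^ 8"
  shows "norm (\<Sum>p\<in>hyp_pairs z. f (nat \<lfloor>t ^ 14 / real (fst p * snd p)\<rfloor>))
           \<le> M * (1 + ln (t ^ 14))\<^sup>2 * t powr (8 + 6 * \<alpha>)"
proof -
  define x where "x = t ^ 14"
  have t: "t > 0" using assms by simp
  have x: "x \<ge> 1" using assms by (simp add: x_def one_le_power)
  have tx: "t ^ 8 \<le> x" unfolding x_def using assms by (intro power_increasing) auto
  have "norm (\<Sum>p\<in>hyp_pairs z. f (nat \<lfloor>x / real (fst p * snd p)\<rfloor>))
      \<le> (\<Sum>p\<in>hyp_pairs z. M * t powr (8 + 6 * \<alpha>) * (1 / real (fst p * snd p)))"
  proof (rule sum_norm_le)
    fix p assume p: "p \<in> hyp_pairs z"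
    define q where "q = real (fst p * snd p)"
    have "q \<ge> 1" "q \<le> z" using p by (auto simp: q_def hyp_pairs_def simp flip: of_nat_mult)
    hence q: "q \<ge> 1" "q \<le> t ^ 8" using assms by auto
    define v where "v = nat \<lfloor>x / q\<rfloor>"
    have "x / q \<ge> 1" using q tx by simp
    hence v: "v \<ge> 1" "real v \<le> x / q" by (simp_all add: v_def le_nat_floor)
    have "norm (f v) \<le> M * real v powr \<alpha>" using f v by simp
    also have "\<dots> \<le> M * (x / q) powr \<alpha>" using v assms by (intro mult_left_mono powr_mono2) auto
    also have "(x / q) powr \<alpha> = x powr \<alpha> * (q powr (1 - \<alpha>) / q)"
      using q x by (simp add: powr_divide powr_diff)
    also have "\<dots> \<le> x powr \<alpha> * ((t ^ 8) powr (1 - \<alpha>) / q)"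
      using q assms by (intro mult_left_mono divide_right_mono powr_mono2) auto
    also have "x powr \<alpha> * ((t ^ 8) powr (1 - \<alpha>) / q) = t powr (8 + 6 * \<alpha>) * (1 / q)"
    proof -
      have "x powr \<alpha> = t powr (14 * \<alpha>)" "(t ^ 8) powr (1 - \<alpha>) = t powr (8 * (1 - \<alpha>))"
        using t by (simp_all add: x_def powr_powr flip: powr_numeral)
      thus ?thesis by (simp add: algebra_simps flip: powr_add)
    qed
    finally show "norm (f (nat \<lfloor>x / real (fst p * snd p)\<rfloor>)) \<le> M * t powr (8 + 6 * \<alpha>) * (1 / real (fst p * snd p))"
      using assms(3) by (simp add: mult_left_mono v_def q_def mult.assoc)
  qed
  also have "\<dots> = M * t powr (8 + 6 * \<alpha>) * (\<Sum>p\<in>hyp_pairs z. 1 / real (fst p * snd p))"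
    by (simp add: sum_distrib_left)
  also have "\<dots> \<le> M * t powr (8 + 6 * \<alpha>) * (1 + ln x)\<^sup>2"
    using assms tx x by (intro mult_left_mono sum_inverse_hyp_pairs_le) auto
  finally show ?thesis by (simp add: x_def mult.commute mult.left_commute)
qed

text \<open>The weights are at most \<open>M * t powr (6 * \<alpha>)\<close>, so the absolute sum of
  the errors suffices. It is counted twice, at \<open>d\<close> and at \<open>Suc d\<close>. The
  index reaches \<open>N + 1\<close>, which is why the preceding bounds allow indices up to
  \<open>2 * t ^ 6\<close>.\<close>

lemma weighted_divisor_error_bound:
  fixes f :: "nat \<Rightarrow> complex"
  assumes "0 \<le> \<alpha>" "M \<ge> 0" and f: "\<And>n. n \<ge> 1 \<Longrightarrow> norm (f n) \<le> M * real n powr \<alpha>"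
    and "t \<ge> 1" "real N \<le> t ^ 6"
  shows "norm (\<Sum>d=1..N. f d * of_real (divisor_error (t ^ 14 / real d) - divisor_error (t ^ 14 / real (Suc d))))
           \<le> 240000 * M * (ln (t ^ 14) + 3) ^ 5 * t powr (8 + 6 * \<alpha>)"
proof -
  let ?e = "\<lambda>d. \<bar>divisor_error (t ^ 14 / real d)\<bar>"
  define A where "A = M * t powr (6 * \<alpha>)"
  have t: "t > 0" using assms by simp
  have A: "A \<ge> 0" using assms by (simp add: A_def)
  have "norm (\<Sum>d=1..N. f d * of_real (divisor_error (t ^ 14 / real d) - divisor_error (t ^ 14 / real (Suc d))))
      \<le> (\<Sum>d=1..N. A * (?e d + ?e (Suc d)))"
  proof (rule sum_norm_le)
    fix d assume d: "d \<in> {1..N}"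
    have "norm (f d) \<le> M * real d powr \<alpha>" using f d by simp
    also have "\<dots> \<le> M * (t ^ 6) powr \<alpha>" using d assms by (intro mult_left_mono powr_mono2) auto
    also have "(t ^ 6) powr \<alpha> = t powr (6 * \<alpha>)" using t by (simp add: powr_powr flip: powr_numeral)
    finally have "norm (f d) \<le> A" by (simp add: A_def)
    thus "norm (f d * of_real (divisor_error (t ^ 14 / real d) - divisor_error (t ^ 14 / real (Suc d)))) \<le> A * (?e d + ?e (Suc d))"
      unfolding norm_mult norm_of_real using A by (intro mult_mono abs_triangle_ineq4) auto
  qed
  also have "\<dots> = A * ((\<Sum>d=1..N. ?e d) + (\<Sum>d=1..N. ?e (Suc d)))"
    unfolding sum_distrib_left[symmetric] sum.distrib ..
  also have "\<dots> \<le> A * (2 * (\<Sum>d=1..Suc N. ?e d))"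
  proof (rule mult_left_mono[OF _ A])
    have "(\<Sum>d=1..N. ?e d) \<le> (\<Sum>d=1..Suc N. ?e d)" by (intro sum_mono2) auto
    moreover have "(\<Sum>d=1..N. ?e (Suc d)) = (\<Sum>d=Suc 1..Suc N. ?e d)"
      by (rule sum.shift_bounds_cl_Suc_ivl[symmetric])
    moreover have "\<dots> \<le> (\<Sum>d=1..Suc N. ?e d)" by (intro sum_mono2) auto
    ultimately show "(\<Sum>d=1..N. ?e d) + (\<Sum>d=1..N. ?e (Suc d)) \<le> 2 * (\<Sum>d=1..Suc N. ?e d)" by linarith
  qed
  also have "\<dots> \<le> A * (2 * (120000 * (ln (t ^ 14) + 3) ^ 5 * t ^ 8))"
  proof (intro mult_left_mono A)
    have "1 \<le> t ^ 6" using assms by (intro one_le_power)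
    hence "real (Suc N) \<le> 2 * t ^ 6" using assms(5) by simp
    thus "(\<Sum>d=1..Suc N. ?e d) \<le> 120000 * (ln (t ^ 14) + 3) ^ 5 * t ^ 8"
      by (intro sum_divisor_error assms(4))
  qed auto
  also have "\<dots> = 240000 * M * (ln (t ^ 14) + 3) ^ 5 * (t powr (6 * \<alpha>) * t powr 8)"
    using t by (simp add: A_def)
  also have "t powr (6 * \<alpha>) * t powr 8 = t powr (8 + 6 * \<alpha>)" by (simp add: add.commute flip: powr_add)
  finally show ?thesis .
qed

section \<open>Assembly of the main terms and the error terms\<close>

theorem theorem1:
  fixes f :: "nat \<Rightarrow> complex" and \<alpha> :: real
  assumes "0 \<le> \<alpha>" and "\<alpha> < 1"
    and "\<exists>M. \<forall>n\<ge>1. norm (f n) \<le> M * real n powr \<alpha>"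
  shows "\<forall>\<epsilon>>0. \<exists>K. \<forall>x\<ge>2.
           norm (T_f f x - C1 f * of_real (x * ln x) - C2 f * of_real x)
             \<le> K * x powr ((4 + 3 * \<alpha>) / 7 + \<epsilon>)"
proof (intro allI impI)
  fix \<epsilon> :: real assume \<epsilon>: "\<epsilon> > 0"
  obtain M where f: "\<And>n. n \<ge> 1 \<Longrightarrow> norm (f n) \<le> M * real n powr \<alpha>" using assms(3) by blast
  have M: "M \<ge> 0" using order_trans[OF norm_ge_zero f[of 1]] by simp
  \<comment> \<open>The exponent \<open>\<eta>\<close> absorbs the logarithm in the terms of
    \<open>C3\<close>. The second entry of the minimum keeps \<open>\<alpha> + \<eta>\<close> below
    1, as \<open>tail_bound\<close> requires.\<close>
  define \<eta> where "\<eta> = min \<epsilon> ((1 - \<alpha>) / 2)"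
  have \<eta>: "\<eta> > 0" "\<eta> \<le> \<epsilon>" "\<alpha> + \<eta> < 1" using \<epsilon> assms by (auto simp: \<eta>_def min_def field_simps)
  define a1 where "a1 = (\<lambda>n. f (n + 1) / of_nat ((n + 1) * (n + 2)))"
  define a3 where "a3 = (\<lambda>n. f (n + 1) * of_real (ln (real (n + 1)) / real (n + 1) - ln (real (n + 2)) / real (n + 2)))"
  define c1 where "c1 = 2 * M / (1 - \<alpha>)"
  define c3 where "c3 = 2 * (M * (1 / \<eta> + 1)) / (1 - (\<alpha> + \<eta>))"
  have c: "c1 \<ge> 0" "c3 \<ge> 0" using assms M \<eta> by (simp_all add: c1_def c3_def)
  have tail1: "norm (C1 f - (\<Sum>n<N. a1 n)) \<le> c1 * real (N + 1) powr (\<alpha> - 1)" for N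
    unfolding C1_def a1_def[symmetric] c1_def
  proof (rule tail_bound)
    fix n
    show "norm (a1 n) \<le> M * real (n + 1) powr \<alpha> / (real (n + 1) * real (n + 2))"
      unfolding a1_def norm_divide norm_of_nat of_nat_mult norm_mult
      by (rule divide_right_mono[OF f]) simp_all
  qed (use assms M in auto)
  have tail3: "norm (C3 f - (\<Sum>n<N. a3 n)) \<le> c3 * real (N + 1) powr (\<alpha> + \<eta> - 1)" for N
    unfolding C3_def a3_def[symmetric] c3_def
  proof (rule tail_bound)
    fix n
    define r where "r = real (n + 1)"
    have "1 + ln r \<le> (1 / \<eta> + 1) * r powr \<eta>"
      using ln_power_le_powr[of r \<eta> 1 1] \<eta> by (simp add: r_def add.commute)
    hence "(1 + ln r) / (r * real (n + 2)) \<le> (1 / \<eta> + 1) * r powr \<eta> / (r * real (n + 2))"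
      by (rule divide_right_mono) (simp add: r_def)
    hence "\<bar>ln r / r - ln (real (n + 2)) / real (n + 2)\<bar> \<le> (1 / \<eta> + 1) * r powr \<eta> / (r * real (n + 2))"
      using abs_ln_quotient_diff_le[of "n + 1"] by (simp add: r_def)
    hence "norm (a3 n) \<le> (M * r powr \<alpha>) * ((1 / \<eta> + 1) * r powr \<eta> / (r * real (n + 2)))"
      unfolding a3_def norm_mult norm_of_real r_def using f[of "n + 1"] M
      by (intro mult_mono) auto
    thus "norm (a3 n) \<le> M * (1 / \<eta> + 1) * real (n + 1) powr (\<alpha> + \<eta>) / (real (n + 1) * real (n + 2))"
      by (simp add: r_def powr_add mult_ac)
  qed (use assms M \<eta> in auto)
  \<comment> \<open>With exponent \<open>\<epsilon> / 10\<close> for one logarithm, five logarithms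
    cost \<open>x powr (\<epsilon> / 2)\<close>.\<close>
  define C where "C = (1 / (\<epsilon> / 10) + 3) ^ 5"
  have "norm (T_f f x - C1 f * of_real (x * ln x) - C2 f * of_real x)
      \<le> ((c1 + c3 + 240001 * M) * C) * x powr ((4 + 3 * \<alpha>) / 7 + \<epsilon>)" if x2: "x \<ge> 2" for x
  proof -
    define t where "t = x powr (1 / 14)"
    have t: "t \<ge> 1" "t > 0" using x2 by (auto simp: t_def intro: ge_one_powr_ge_zero)
    have tp: "t powr a = x powr (a / 14)" for a using x2 by (simp add: t_def powr_powr)
    have x: "x = t ^ 14" using x2 tp[of 14] t by simp
    define N where "N = nat \<lfloor>t ^ 6\<rfloor>"
    have N: "real N \<le> t ^ 6" "t ^ 6 \<le> real (N + 1)" using t by (simp_all add: N_def) linarith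
    define l where "l = ln x + 3"
    have l: "l \<ge> 3" using x2 by (simp add: l_def)
    have l5: "1 \<le> l ^ 5" "l \<le> l ^ 5" "(1 + ln x)\<^sup>2 \<le> l ^ 5"
    proof -
      show "1 \<le> l ^ 5" "l \<le> l ^ 5" using l by (auto intro: one_le_power self_le_power)
      have "(1 + ln x)\<^sup>2 \<le> l\<^sup>2" using x2 by (intro power_mono) (auto simp: l_def)
      also have "\<dots> \<le> l ^ 5" using l by (intro power_increasing) auto
      finally show "(1 + ln x)\<^sup>2 \<le> l ^ 5" .
    qed
    define E where "E = t powr (8 + 6 * (\<alpha> + \<eta>))"
    have E: "t powr (8 + 6 * \<alpha>) \<le> E" unfolding E_def using t \<eta> by (intro powr_mono) auto
    \<comment> \<open>The cut \<open>N\<close> is about \<open>t ^ 6\<close>, and 14 + 6 (\<beta> -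
      1) = 8 + 6 \<beta>, so the tails of the series have the same order as the other
      errors.\<close>
    have tail_scale: "x * real (N + 1) powr (\<beta> - 1) \<le> t powr (8 + 6 * \<beta>)" if "\<beta> < 1" for \<beta>
    proof -
      have "real (N + 1) powr (\<beta> - 1) \<le> (t ^ 6) powr (\<beta> - 1)"
        using N t that by (intro powr_mono2') auto
      also have "\<dots> = t powr (6 * (\<beta> - 1))" using t by (simp add: powr_powr flip: powr_numeral)
      finally have "x * real (N + 1) powr (\<beta> - 1) \<le> t powr 14 * t powr (6 * (\<beta> - 1))"
        using t by (simp add: x)
      also have "\<dots> = t powr (8 + 6 * \<beta>)" by (simp add: algebra_simps flip: powr_add)
      finally show ?thesis .
    qed
    define A where "A = x * ln x + (2 * euler_mascheroni - 1) * x"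
    \<comment> \<open>The summation index of \<open>a1\<close> and \<open>a3\<close> is
      \<open>d - 1\<close>, so \<open>n < N\<close> corresponds to \<open>d = 1..N\<close>.\<close>
    define P1 where "P1 = (\<Sum>n<N. a1 n)"
    define P3 where "P3 = (\<Sum>n<N. a3 n)"
    define S where "S = (\<Sum>p\<in>hyp_pairs (x / real (Suc N)). f (nat \<lfloor>x / real (fst p * snd p)\<rfloor>))"
    define R where "R = (\<Sum>d=1..N. f d * of_real (divisor_error (x / real d) - divisor_error (x / real (Suc d))))"
    have "T_f f x = (\<Sum>p\<in>hyp_pairs x. f (nat \<lfloor>x / real (fst p * snd p)\<rfloor>))"
      by (simp add: T_f_def hyp_pairs_def)
    also have "\<dots> = S + (\<Sum>d=1..N. f d * of_real (real (divisor_sum (x / real d)) - real (divisor_sum (x / real (Suc d)))))"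
      unfolding S_def using x2 by (intro sum_hyp_pairs_by_quotient) auto
    also have "(\<Sum>d=1..N. f d * of_real (real (divisor_sum (x / real d)) - real (divisor_sum (x / real (Suc d)))))
        = (\<Sum>d=1..N. f d * of_real (divisor_main (x / real d) - divisor_main (x / real (Suc d)))) + R"
      unfolding R_def sum.distrib[symmetric]
      by (intro sum.cong refl) (simp add: divisor_error_def algebra_simps)
    also have "(\<Sum>d=1..N. f d * of_real (divisor_main (x / real d) - divisor_main (x / real (Suc d))))
        = (\<Sum>n<N. of_real A * a1 n - of_real x * a3 n)"
    proof (rule sum.reindex_bij_witness[of _ Suc "\<lambda>d. d - 1"])
      fix d assume d: "d \<in> {1..N}"
      then obtain n where [simp]: "d = Suc n" by (cases d) auto
      show "of_real A * a1 (d - 1) - of_real x * a3 (d - 1) =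
          f d * of_real (divisor_main (x / real d) - divisor_main (x / real (Suc d)))"
        using x2 d
        by (subst divisor_main_diff) (auto simp: a1_def a3_def A_def algebra_simps)
    qed auto
    also have "\<dots> = of_real A * P1 - of_real x * P3"
      by (simp add: sum_subtractf P1_def P3_def sum_distrib_left)
    \<comment> \<open>Completing the partial sums \<open>P1\<close> and \<open>P3\<close> to
      \<open>C1 f\<close> and \<open>C3 f\<close> produces the main terms and leaves only the two
      tails.\<close>
    finally have "T_f f x - C1 f * of_real (x * ln x) - C2 f * of_real x =
        S + R + (of_real x * (C3 f - P3) - of_real A * (C1 f - P1))"
      by (simp add: C2_def A_def algebra_simps)
    also have "norm \<dots> \<le> norm S + norm R + (norm (of_real x * (C3 f - P3)) + norm (of_real A * (C1 f - P1)))"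
      by (intro norm_triangle_mono norm_triangle_le_diff order_refl)
    also have "\<dots> \<le> M * l ^ 5 * E + 240000 * M * l ^ 5 * E + (c3 * l ^ 5 * E + c1 * l ^ 5 * E)"
    proof (intro add_mono)
      have "x / real (Suc N) \<le> x / t ^ 6" using N t by (intro divide_left_mono) (auto simp: x)
      also have "\<dots> = t ^ 8" using t by (simp add: x flip: power_diff)
      finally have "norm S \<le> M * (1 + ln x)\<^sup>2 * t powr (8 + 6 * \<alpha>)"
        unfolding S_def x using small_quotient_part_bound[OF assms(1,2) M f t(1)] by simp
      also have "\<dots> \<le> M * l ^ 5 * E" using M l l5 E by (intro mult_mono) auto
      finally show "norm S \<le> M * l ^ 5 * E" .
      have "norm R \<le> 240000 * M * l ^ 5 * t powr (8 + 6 * \<alpha>)"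
        unfolding R_def l_def x using weighted_divisor_error_bound[OF assms(1) M f t(1) N(1)] by simp
      also have "\<dots> \<le> 240000 * M * l ^ 5 * E" using M l E by (intro mult_left_mono) auto
      finally show "norm R \<le> 240000 * M * l ^ 5 * E" .
      have "norm (of_real x * (C3 f - P3)) \<le> x * (c3 * real (N + 1) powr (\<alpha> + \<eta> - 1))"
        unfolding norm_mult norm_of_real P3_def using tail3[of N] x2 by (intro mult_mono) auto
      also have "\<dots> = c3 * (x * real (N + 1) powr (\<alpha> + \<eta> - 1))" by simp
      also have "\<dots> \<le> c3 * E" unfolding E_def using tail_scale[OF \<eta>(3)] c by (intro mult_left_mono) auto
      also have "\<dots> \<le> (c3 * E) * l ^ 5" using mult_left_mono[OF l5(1), of "c3 * E"] c by (simp add: E_def)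
      finally show "norm (of_real x * (C3 f - P3)) \<le> c3 * l ^ 5 * E" by (simp add: mult_ac)
      have "\<bar>A\<bar> \<le> x * l"
      proof -
        have "A = x * (ln x + (2 * euler_mascheroni - 1))" by (simp add: A_def algebra_simps)
        moreover have "\<bar>ln x + (2 * euler_mascheroni - 1)\<bar> \<le> l"
          using x2 euler_mascheroni_gt_19_over_33 euler_mascheroni_less_13_over_22 ln_ge_zero[of x]
          unfolding l_def by linarith
        ultimately show ?thesis using x2 by (simp add: abs_mult)
      qed
      hence "norm (of_real A * (C1 f - P1)) \<le> (x * l) * (c1 * real (N + 1) powr (\<alpha> - 1))"
        unfolding norm_mult norm_of_real P1_def using tail1[of N] x2 l by (intro mult_mono) auto
      also have "\<dots> = c1 * l * (x * real (N + 1) powr (\<alpha> - 1))" by simp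
      also have "\<dots> \<le> c1 * l ^ 5 * E"
        using tail_scale[OF assms(2)] E c l l5 x2 by (intro mult_mono) auto
      finally show "norm (of_real A * (C1 f - P1)) \<le> c1 * l ^ 5 * E" .
    qed
    also have "\<dots> = (c1 + c3 + 240001 * M) * (l ^ 5 * E)" by (simp add: algebra_simps)
    also have "\<dots> \<le> (c1 + c3 + 240001 * M) * (C * x powr ((4 + 3 * \<alpha>) / 7 + \<epsilon>))"
    proof (rule mult_left_mono)
      have "l ^ 5 \<le> C * x powr (\<epsilon> / 2)"
        using ln_power_le_powr[of x "\<epsilon> / 10" 3 5] x2 \<epsilon> by (simp add: l_def C_def)
      hence "l ^ 5 * E \<le> C * x powr (\<epsilon> / 2) * E" by (rule mult_right_mono) (simp add: E_def)
      also have "\<dots> = C * x powr (\<epsilon> / 2 + (8 + 6 * (\<alpha> + \<eta>)) / 14)" unfolding E_def tp by (simp only: powr_add mult.assoc)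
      also have "\<dots> \<le> C * x powr ((4 + 3 * \<alpha>) / 7 + \<epsilon>)"
      proof (intro mult_left_mono powr_mono)
        \<comment> \<open>Beyond the target exponent this leaves 3 \<eta> / 7 + \<epsilon> / 2,
          which is at most \<epsilon> because \<eta> does not exceed \<epsilon>.\<close>
        show "\<epsilon> / 2 + (8 + 6 * (\<alpha> + \<eta>)) / 14 \<le> (4 + 3 * \<alpha>) / 7 + \<epsilon>"
          using \<epsilon> \<eta>(2) by (simp add: field_simps)
      qed (use x2 \<epsilon> in \<open>auto simp: C_def\<close>)
      finally show "l ^ 5 * E \<le> C * x powr ((4 + 3 * \<alpha>) / 7 + \<epsilon>)" .
    qed (use c M in auto)
    finally show ?thesis by (simp add: mult.assoc)
  qed
  thus "\<exists>K. \<forall>x\<ge>2. norm (T_f f x - C1 f * of_real (x * ln x) - C2 f * of_real x)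
             \<le> K * x powr ((4 + 3 * \<alpha>) / 7 + \<epsilon>)" by blast
qed

end
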